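(* Suppose that the tensor $\mathcal U$ with bond dimension $D$ generates a type I (respectively, type II) fermionic matrix product unitary $U^{(N)}$ with antiperiodic boundary conditions. Then there exists $k\le D^4$ such that the blocked tensor $\mathcal U_k$ is simple.
   Context: Each site carries a $\mathbb Z_2$-graded space of dimension $d$ with homogeneous orthonormal basis $|n\rangle$ of parity $|n|\in\{0,1\}$. On the $N$-site chain with basis $|p_1,\dots,p_N\rangle$ set $f_x^{n,m}|p_1,\dots,p_N\rangle=\delta_{m,p_x}(-1)^{(|n|+|m|)\sum_{y<x}|p_y|}|p_1,\dots,n,\dots,p_N\rangle$ ($n$ in position $x$). An even tensor $\mathcal U$ consists of $D\times D$ matrices $U^{n,m}$ with entries $U^{n,m}_{\alpha,\beta}$ and a diagonal matrix $Z$ with entries $\pm1$, $Z|\alpha)=(-1)^{|\alpha|}|\alpha)$, such that $ZU^{n,m}=(-1)^{|n|+|m|}U^{n,m}Z$. It generates, with antiperiodic boundary conditions, $U^{(N)}=\sum\mathrm{tr}(S\,U^{n_1,m_1}\cdots U^{n_N,m_N})f_1^{n_1,m_1}\cdots f_N^{n_N,m_N}$; this is a type I fMPU if $S=e^{i\alpha}\mathbb 1$, $\alpha\in\mathbb R$, and $U^{(N)}$ is unitary for all $N\ge1$; it is a type II fMPU if $U^{(N)}$ is unitary for all $N\ge1$, $S=\frac{e^{i\alpha}}{\sqrt2}\mathbb 1$, the auxiliary space is $\mathbb C^2\otimes\mathbb C^{D/2}$ with $Z=\sigma^z\otimes\mathbb 1$, and $U^{n,m}=(\sigma^x)^{|n|+|m|}\otimes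 N^{n,m}$ for some matrices $N^{n,m}$. Blocking two sites gives the tensor with output index $(n,p)$, input index $(m,q)$, matrices $(-1)^{|m|(|p|+|q|)}U^{n,m}U^{p,q}$ and $|(n,p)|=|n|+|p|$ mod 2; $\mathcal U_k$ is the tensor obtained by blocking $k$ sites (iterating this rule). For a tensor $\mathcal U$ with physical dimension $d$ put $\mathbb U^{k,i}_{(\alpha,\gamma),(\beta,\delta)}=\sum_j(-1)^{|\beta|(|k|+|i|)}\overline{U^{j,k}_{\alpha,\beta}}\,U^{j,i}_{\gamma,\delta}$ and $E_{\mathcal U}=\frac1d\sum_i\mathbb U^{i,i}$ (transfer matrix). $\mathcal U$ is simple if $E_{\mathcal U}^2=E_{\mathcal U}$, $E_{\mathcal U}\mathbb U^{k,i}E_{\mathcal U}=\delta_{k,i}E_{\mathcal U}$, and $\mathbb U^{k,i}\mathbb U^{k',i'}=\mathbb U^{k,i}E_{\mathcal U}\mathbb U^{k',i'}$ for all $k,i,k',i'$. *)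

theory Defs
  imports "HOL-Analysis.Analysis"
begin

text \<open>
  A tensor with bond dimension \<open>D = CARD('b)\<close> over a graded physical space of dimension
  \<open>d = card (labels T)\<close>. Parities of physical and auxiliary basis vectors are the
  numbers 0 and 1. The physical labels form a subset of a type, so that
  all the blocked tensors of a tensor can live in one type of labels, namely lists.
\<close>

record ('p, 'b::finite) ftensor =
  labels :: "'p set"
  par :: "'p \<Rightarrow> nat"
  apar :: "'b \<Rightarrow> nat"
  ent :: "'p \<Rightarrow> 'p \<Rightarrow> complex ^ 'b ^ 'b"

definition Zmat :: "('p, 'b::finite) ftensor \<Rightarrow> complex ^ 'b ^ 'b" where
  "Zmat T = (\<chi> \<alpha> \<beta>. if \<alpha> = \<beta> then (- 1) ^ apar T \<alpha> else 0)"

definition even_tensor :: "('p, 'b::finite) ftensor \<Rightarrow> bool" where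
  "even_tensor T \<longleftrightarrow>
     finite (labels T) \<and> labels T \<noteq> {} \<and>
     (\<forall>n\<in>labels T. par T n \<in> {0, 1}) \<and>
     (\<forall>\<alpha>. apar T \<alpha> \<in> {0, 1}) \<and>
     (\<forall>n\<in>labels T. \<forall>m\<in>labels T.
        Zmat T ** ent T n m = ((- 1) ^ (par T n + par T m) :: real) *\<^sub>R (ent T n m ** Zmat T))"

text \<open>
  Operators on the \<open>N\<close>-site chain are given by their matrix elements
  \<open>A p' p = \<langle>p'|A|p\<rangle>\<close> between basis configurations. Sites are numbered from 0.
\<close>

type_synonym 'p chain_op = "'p list \<Rightarrow> 'p list \<Rightarrow> complex"

definition confs :: "('p, 'b::finite) ftensor \<Rightarrow> nat \<Rightarrow> 'p list set" where
  "confs T N = {p. length p = N \<and> set p \<subseteq> labels T}"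

definition op_id :: "'p chain_op" where
  "op_id = (\<lambda>p' p. if p' = p then 1 else 0)"

definition op_mult :: "('p, 'b::finite) ftensor \<Rightarrow> nat \<Rightarrow> 'p chain_op \<Rightarrow> 'p chain_op \<Rightarrow> 'p chain_op" where
  "op_mult T N A B = (\<lambda>p' p. \<Sum>q\<in>confs T N. A p' q * B q p)"

definition op_adj :: "'p chain_op \<Rightarrow> 'p chain_op" where
  "op_adj A = (\<lambda>p' p. cnj (A p p'))"

definition unitary_op :: "('p, 'b::finite) ftensor \<Rightarrow> nat \<Rightarrow> 'p chain_op \<Rightarrow> bool" where
  "unitary_op T N A \<longleftrightarrow>
     (\<forall>p'\<in>confs T N. \<forall>p\<in>confs T N.
        op_mult T N (op_adj A) A p' p = op_id p' p \<and>
        op_mult T N A (op_adj A) p' p = op_id p' p)"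

definition f_op :: "('p, 'b::finite) ftensor \<Rightarrow> nat \<Rightarrow> 'p \<Rightarrow> 'p \<Rightarrow> 'p chain_op" where
  "f_op T x n m = (\<lambda>p' p.
     if p ! x = m \<and> p' = p[x := n]
     then (- 1) ^ ((par T n + par T m) * (\<Sum>y<x. par T (p ! y))) else 0)"

definition f_prod :: "('p, 'b::finite) ftensor \<Rightarrow> nat \<Rightarrow> 'p list \<Rightarrow> 'p list \<Rightarrow> 'p chain_op" where
  "f_prod T N ns ms =
     foldr (op_mult T N) (map (\<lambda>x. f_op T x (ns ! x) (ms ! x)) [0..<N]) op_id"

definition ent_prod ::
    "('p, 'b::finite) ftensor \<Rightarrow> 'p list \<Rightarrow> 'p list \<Rightarrow> complex ^ 'b ^ 'b" where
  "ent_prod T ns ms = foldr (**) (map2 (ent T) ns ms) (mat 1)"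

definition mpo :: "complex ^ 'b ^ 'b \<Rightarrow> ('p, 'b::finite) ftensor \<Rightarrow> nat \<Rightarrow> 'p chain_op" where
  "mpo S T N = (\<lambda>p' p.
     \<Sum>ns\<in>confs T N. \<Sum>ms\<in>confs T N. trace (S ** ent_prod T ns ms) * f_prod T N ns ms p' p)"

definition type_I_fMPU :: "complex ^ 'b ^ 'b \<Rightarrow> ('p, 'b::finite) ftensor \<Rightarrow> bool" where
  "type_I_fMPU S T \<longleftrightarrow>
     even_tensor T \<and>
     (\<exists>\<alpha>::real. S = mat (cis \<alpha>)) \<and>
     (\<forall>N\<ge>1. unitary_op T N (mpo S T N))"

text \<open>The auxiliary space of a type II tensor, the tensor product of a two-dimensional space
  with one of dimension \<open>D/2\<close>, has the index type \<open>bool \<times> 'h\<close>. Here \<open>False\<close> and \<open>True\<close>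
  label the eigenvectors of \<open>\<sigma>\<^sup>z\<close> for the eigenvalues 1 and \<open>-1\<close>.\<close>

definition sigma_x :: "complex ^ bool ^ bool" where
  "sigma_x = (\<chi> a b. if a \<noteq> b then 1 else 0)"

definition sigma_z :: "complex ^ bool ^ bool" where
  "sigma_z = (\<chi> a b. if a = b then (if a then - 1 else 1) else 0)"

definition mpow :: "complex ^ 'a ^ 'a \<Rightarrow> nat \<Rightarrow> complex ^ 'a::finite ^ 'a" where
  "mpow A k = ((**) A ^^ k) (mat 1)"

definition kron ::
    "complex ^ 'a ^ 'a \<Rightarrow> complex ^ 'h ^ 'h \<Rightarrow> complex ^ ('a::finite \<times> 'h::finite) ^ ('a \<times> 'h)" where
  "kron A B = (\<chi> i j. A $ fst i $ fst j * B $ snd i $ snd j)"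

definition type_II_fMPU ::
    "complex ^ (bool \<times> 'h) ^ (bool \<times> 'h) \<Rightarrow> ('p, bool \<times> 'h::finite) ftensor \<Rightarrow> bool" where
  "type_II_fMPU S T \<longleftrightarrow>
     even_tensor T \<and>
     (\<exists>\<alpha>::real. S = mat (cis \<alpha> / complex_of_real (sqrt 2))) \<and>
     Zmat T = kron sigma_z (mat 1) \<and>
     (\<exists>Nm :: 'p \<Rightarrow> 'p \<Rightarrow> complex ^ 'h ^ 'h. \<forall>n\<in>labels T. \<forall>m\<in>labels T.
        ent T n m = kron (mpow sigma_x (par T n + par T m)) (Nm n m)) \<and>
     (\<forall>N\<ge>1. unitary_op T N (mpo S T N))"

text \<open>Meant for \<open>T\<close> and \<open>T'\<close> with the same auxiliary parities.\<close>

definition block ::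
    "('p, 'b::finite) ftensor \<Rightarrow> ('q, 'b) ftensor \<Rightarrow> ('p \<times> 'q, 'b) ftensor" where
  "block T T' =
    \<lparr> labels = labels T \<times> labels T',
      par = (\<lambda>(n, p). (par T n + par T' p) mod 2),
      apar = apar T,
      ent = (\<lambda>(n, p) (m, q).
        ((- 1) ^ (par T m * (par T' p + par T' q)) :: real) *\<^sub>R (ent T n m ** ent T' p q)) \<rparr>"

text \<open>To iterate \<open>block\<close> within one type, the pair \<open>(n, ns)\<close> is relabelled as the list \<open>n # ns\<close>.\<close>

definition cons_labels :: "('p \<times> 'p list, 'b::finite) ftensor \<Rightarrow> ('p list, 'b) ftensor" where
  "cons_labels T =
    \<lparr> labels = (\<lambda>(n, ns). n # ns) ` labels T,
      par = (\<lambda>ns. par T (hd ns, tl ns)),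
      apar = apar T,
      ent = (\<lambda>ns ms. ent T (hd ns, tl ns) (hd ms, tl ms)) \<rparr>"

text \<open>The recursion starts from the trivial tensor (one even label, matrix \<open>1\<close>), so that
  \<open>blocked T 1\<close> is \<open>T\<close> with \<open>n\<close> relabelled as \<open>[n]\<close>.\<close>

primrec blocked :: "('p, 'b::finite) ftensor \<Rightarrow> nat \<Rightarrow> ('p list, 'b) ftensor" where
  "blocked T 0 = \<lparr> labels = {[]}, par = (\<lambda>_. 0), apar = apar T, ent = (\<lambda>_ _. mat 1) \<rparr>"
| "blocked T (Suc k) = cons_labels (block T (blocked T k))"

definition double_ent ::
    "('p, 'b::finite) ftensor \<Rightarrow> 'p \<Rightarrow> 'p \<Rightarrow> complex ^ ('b \<times> 'b) ^ ('b \<times> 'b)" where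
  "double_ent T k i = (\<chi> r c. case (r, c) of ((\<alpha>, \<gamma>), (\<beta>, \<delta>)) \<Rightarrow>
     \<Sum>j\<in>labels T. (- 1) ^ (apar T \<beta> * (par T k + par T i)) *
       cnj (ent T j k $ \<alpha> $ \<beta>) * ent T j i $ \<gamma> $ \<delta>)"

definition transfer_mat ::
    "('p, 'b::finite) ftensor \<Rightarrow> complex ^ ('b \<times> 'b) ^ ('b \<times> 'b)" where
  "transfer_mat T = (1 / real (card (labels T))) *\<^sub>R (\<Sum>i\<in>labels T. double_ent T i i)"

definition simple_tensor :: "('p, 'b::finite) ftensor \<Rightarrow> bool" where
  "simple_tensor T \<longleftrightarrow>
     transfer_mat T ** transfer_mat T = transfer_mat T \<and>
     (\<forall>k\<in>labels T. \<forall>i\<in>labels T.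
        transfer_mat T ** double_ent T k i ** transfer_mat T = (if k = i then transfer_mat T else 0)) \<and>
     (\<forall>k\<in>labels T. \<forall>i\<in>labels T. \<forall>k'\<in>labels T. \<forall>i'\<in>labels T.
        double_ent T k i ** double_ent T k' i' =
        double_ent T k i ** transfer_mat T ** double_ent T k' i')"

end

theory Submission
  imports Defs
begin

text \<open>
  Since the operators generated by \<open>T\<close> are unitary, every product of \<open>N\<close> of the matrices \<open>double_ent T k i\<close> has trace 1 if its
  upper and lower index words agree, and 0 otherwise (2 instead of 1 for type II). Hence the trace is
  multiplicative on the nonunital algebra \<open>A\<close> spanned by these products, and its kernel \<open>I\<close> is an ideal
  of matrices all of whose powers are traceless, so that they are nilpotent. An Engel-type argument shows that all products
  of \<open>n = D\<^sup>2\<close> elements of \<open>I\<close> vanish. An idempotent \<open>P\<close> of \<open>A\<close> with trace 1 has rank one, so that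
  \<open>P x P = (tr x) P\<close> and \<open>P I P = 0\<close>; moreover \<open>E\<^sup>n = P\<close>, and writing every factor as \<open>(tr x) P + y\<close>
  with \<open>y\<close> in \<open>I\<close> gives \<open>w (1 - P) w' = 0\<close> for words \<open>w\<close>, \<open>w'\<close> of length \<open>n\<close>. So \<open>k = D\<^sup>2\<close> works.
  For type II, two anticommuting matrices commute with all the \<open>double_ent T k i\<close>, and the argument
  applies to one of the two equivalent halves of the space.
\<close>

subsection \<open>Matrix arithmetic\<close>

lemma matrix_mul_diff_left: "(A - B) ** C = A ** C - B ** (C :: 'a::ring_1^'n^'m::finite)"
  by (simp add: matrix_matrix_mult_def vec_eq_iff sum_subtractf left_diff_distrib)

lemma matrix_mul_diff_right: "A ** (B - C) = A ** B - A ** (C :: 'a::ring_1^'n^'m::finite)"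
  by (simp add: matrix_matrix_mult_def vec_eq_iff sum_subtractf right_diff_distrib)

lemma matrix_mul_add_left: "(A + B) ** C = A ** C + B ** (C :: 'a::semiring_1^'n^'m::finite)"
  by (simp add: matrix_matrix_mult_def vec_eq_iff sum.distrib distrib_right)

lemma matrix_mul_zero_left: "0 ** A = (0 :: 'a::semiring_1^'n^'m)"
  by (simp add: matrix_matrix_mult_def vec_eq_iff)

lemma matrix_mul_zero_right: "A ** 0 = (0 :: 'a::semiring_1^'n^'m)"
  by (simp add: matrix_matrix_mult_def vec_eq_iff)

lemma matrix_mul_scaleR_left: "(r *\<^sub>R A) ** B = r *\<^sub>R (A ** (B :: 'a::real_algebra_1^'n^'m::finite))"
  by (simp add: matrix_matrix_mult_def vec_eq_iff scaleR_sum_right)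

lemma matrix_mul_scaleR_right: "A ** (r *\<^sub>R B) = r *\<^sub>R (A ** (B :: 'a::real_algebra_1^'n^'m::finite))"
  by (simp add: matrix_matrix_mult_def vec_eq_iff scaleR_sum_right)

lemma matrix_mul_minus_left: "(- A) ** B = - (A ** (B :: 'a::ring_1^'n^'m::finite))"
  by (simp add: matrix_matrix_mult_def vec_eq_iff sum_negf)

lemma matrix_mul_minus_right: "A ** (- B) = - (A ** (B :: 'a::ring_1^'n^'m::finite))"
  by (simp add: matrix_matrix_mult_def vec_eq_iff sum_negf)

lemma matrix_mul_sum_right: "A ** (\<Sum>i\<in>I. f i) = (\<Sum>i\<in>I. A ** (f i :: 'a::semiring_1^'n^'m::finite))"
  by (induction I rule: infinite_finite_induct) (simp_all add: matrix_mul_zero_right matrix_add_ldistrib)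

lemma matrix_mul_sum_left: "(\<Sum>i\<in>I. f i) ** A = (\<Sum>i\<in>I. f i ** (A :: 'a::semiring_1^'n^'m::finite))"
  by (induction I rule: infinite_finite_induct) (simp_all add: matrix_mul_zero_left matrix_mul_add_left)

lemma matrix_vector_scaleR_left: "(r *\<^sub>R A) *v x = r *\<^sub>R (A *v (x :: 'a::real_algebra_1^'n::finite))"
  by (simp add: matrix_vector_mult_def vec_eq_iff scaleR_sum_right)

lemma trace_zero: "trace 0 = (0 :: 'a::semiring_1)"
  by (simp add: trace_def)

lemma trace_scaleR: "trace (r *\<^sub>R A) = r *\<^sub>R trace (A :: 'a::real_algebra_1^'n^'n)"
  by (simp add: trace_def scaleR_sum_right)

lemma trace_sum: "trace (\<Sum>i\<in>I. f i) = (\<Sum>i\<in>I. trace (f i :: 'a::comm_semiring_1^'n^'n))"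
  by (induction I rule: infinite_finite_induct) (simp_all add: trace_zero trace_add)

lemmas matrix_mul_simps = matrix_mul_diff_left matrix_mul_diff_right matrix_mul_add_left
  matrix_add_ldistrib matrix_mul_zero_left matrix_mul_zero_right matrix_mul_scaleR_left
  matrix_mul_scaleR_right matrix_mul_minus_left matrix_mul_minus_right

definition mprod :: "(complex^'m^'m) list \<Rightarrow> complex^'m::finite^'m" where
  "mprod xs = foldr (**) xs (mat 1)"

lemma mprod_Nil [simp]: "mprod [] = mat 1"
  and mprod_Cons [simp]: "mprod (x # xs) = x ** mprod xs"
  by (simp_all add: mprod_def)

lemma mprod_append: "mprod (xs @ ys) = mprod xs ** mprod ys"
  by (induction xs) (simp_all add: matrix_mul_assoc)

lemma mpow_0 [simp]: "mpow A 0 = mat 1"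
  and mpow_Suc [simp]: "mpow A (Suc k) = A ** mpow A k"
  by (simp_all add: mpow_def)

lemma mpow_add: "mpow A (j + k) = mpow A j ** mpow A k"
  by (induction j) (simp_all add: matrix_mul_assoc)

lemma mprod_replicate: "mprod (replicate k A) = mpow A k"
  by (induction k) simp_all

subsection \<open>Idempotent matrices\<close>

text \<open>A rank factorization: \<open>Bs\<close> is a basis of the range of \<open>e\<close>, and
  \<open>l b j\<close> is the \<open>b\<close>-coordinate of column \<open>j\<close>. The trace
  counts the basis because \<open>e\<close> fixes its range.\<close>

lemma idempotent_matrix_factorization:
  fixes e :: "complex^'m^'m"
  assumes e: "e ** e = e"
  obtains Bs :: "(complex^'m) set" and l :: "complex^'m \<Rightarrow> 'm \<Rightarrow> complex"
  where "finite Bs" "trace e = of_nat (card Bs)" "\<And>i j. e $ i $ j = (\<Sum>b\<in>Bs. b $ i * l b j)"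
proof -
  let ?V = "range ((*v) e)"
  obtain Bs where Bs: "Bs \<subseteq> ?V" "vec.independent Bs" "?V \<subseteq> vec.span Bs"
    by (metis vec.basis_exists)
  have fin: "finite Bs"
    using Bs(2) vec.finiteI_independent by blast
  define l where "l b j = vec.representation Bs (e *v axis j 1) b" for b j
  have ax: "(e *v axis j 1) $ i = e $ i $ j" for i j
  proof -
    have "e $ i $ k * axis j 1 $ k = (if k = j then e $ i $ k else 0)" for k
      by (simp add: axis_def)
    then show ?thesis
      by (simp add: matrix_vector_mult_def)
  qed
  have fact: "e $ i $ j = (\<Sum>b\<in>Bs. b $ i * l b j)" for i j
  proof -
    have "(\<Sum>b\<in>Bs. vec.representation Bs (e *v axis j 1) b *s b) = e *v axis j 1"
      using Bs fin by (intro vec.sum_representation_eq) auto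
    then have "(\<Sum>b\<in>Bs. l b j * b $ i) = (e *v axis j 1) $ i"
      by (metis (no_types, lifting) l_def sum.cong sum_component vector_smult_component)
    then show ?thesis
      by (simp add: mult.commute ax)
  qed
  \<comment> \<open>Expanding \<open>e *v b\<close> in the columns of \<open>e\<close> and reading
    off the \<open>b\<close>-coordinate gives 1, since \<open>e *v b = b\<close>.\<close>
  have one: "(\<Sum>i\<in>UNIV. b $ i * l b i) = 1" if b: "b \<in> Bs" for b
  proof -
    from b Bs(1) obtain x where x: "b = e *v x" by auto
    have eb: "e *v b = b"
      unfolding x by (simp add: matrix_vector_mul_assoc e)
    have "(\<Sum>i\<in>UNIV. b $ i * l b i) = (\<Sum>i\<in>UNIV. vec.representation Bs (b $ i *s (e *v axis i 1)) b)"
      using Bs by (auto intro!: sum.cong simp: l_def vec.representation_scale subset_iff)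
    also have "\<dots> = vec.representation Bs (\<Sum>i\<in>UNIV. b $ i *s (e *v axis i 1)) b"
      using Bs by (subst vec.representation_sum) (auto intro!: vec.span_scale)
    also have "(\<Sum>i\<in>UNIV. b $ i *s (e *v axis i 1)) = e *v b"
      by (simp add: vec_eq_iff ax) (simp add: matrix_vector_mult_def mult.commute)
    also have "vec.representation Bs (e *v b) b = 1"
      using b by (simp add: eb vec.representation_basis Bs(2))
    finally show ?thesis .
  qed
  have "trace e = (\<Sum>b\<in>Bs. \<Sum>i\<in>UNIV. b $ i * l b i)"
    unfolding trace_def fact by (rule sum.swap)
  then have "trace e = of_nat (card Bs)"
    using one by simp
  with that fin fact show ?thesis by blast
qed

lemma idempotent_trace_0:
  fixes e :: "complex^'m^'m"
  assumes "e ** e = e" "trace e = 0"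
  shows "e = 0"
proof -
  from idempotent_matrix_factorization[OF assms(1)] obtain Bs l where
    Bs: "finite Bs" "trace e = of_nat (card Bs)" "\<And>i j. e $ i $ j = (\<Sum>b\<in>Bs. b $ i * l b j)"
    by blast
  then have "Bs = {}" using assms(2) by simp
  with Bs(3) show ?thesis by (simp add: vec_eq_iff)
qed

text \<open>With trace 1 the factorization has a single term, a column \<open>r\<close> times a row
  \<open>l\<close>. So \<open>e x e\<close> is \<open>e\<close> times the number
  \<open>l x r\<close>, which is the trace of \<open>e x\<close>. The complex multiple is written
  entrywise because \<open>*\<^sub>R\<close> takes only real factors.\<close>

lemma idempotent_trace_1:
  fixes e :: "complex^'m^'m"
  assumes "e ** e = e" "trace e = 1"
  shows "e ** x ** e = (\<chi> i j. trace (e ** x) * e $ i $ j)"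
proof -
  from idempotent_matrix_factorization[OF assms(1)] obtain Bs l where
    Bs: "finite Bs" "trace e = of_nat (card Bs)" "\<And>i j. e $ i $ j = (\<Sum>b\<in>Bs. b $ i * l b j)"
    by blast
  then have "card Bs = 1" using assms(2) by simp
  then obtain r where "Bs = {r}" by (auto simp: card_1_singleton_iff)
  then have e: "e $ i $ j = r $ i * l r j" for i j
    using Bs by simp
  define v where "v k = (\<Sum>m\<in>UNIV. l r m * x $ m $ k)" for k
  have ex: "(e ** x) $ i $ k = r $ i * v k" for i k
    by (simp add: matrix_matrix_mult_def e v_def sum_distrib_left mult.assoc)
  have tr: "trace (e ** x) = (\<Sum>k\<in>UNIV. r $ k * v k)"
    by (simp add: trace_def ex)
  have "(e ** x ** e) $ i $ j = (\<Sum>k\<in>UNIV. r $ i * v k * (r $ k * l r j))" for i j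
    by (simp add: matrix_matrix_mult_def[of "e ** x"] ex e)
  also have "(\<Sum>k\<in>UNIV. r $ i * v k * (r $ k * l r j)) = trace (e ** x) * e $ i $ j" for i j
    unfolding tr e sum_distrib_right by (rule sum.cong) simp_all
  finally show ?thesis
    by (simp add: vec_eq_iff)
qed

subsection \<open>Nonunital matrix algebras\<close>

text \<open>No unit is required, as the span of nonempty words need not contain one. Closure is
  under real scalars only, which is enough because the words to which it is applied have real
  traces.\<close>

definition matrix_algebra :: "(complex^'m^'m) set \<Rightarrow> bool" where
  "matrix_algebra A \<longleftrightarrow> subspace A \<and> (\<forall>x\<in>A. \<forall>y\<in>A. x ** y \<in> A)"

lemma matrix_algebra_subspace: "matrix_algebra A \<Longrightarrow> subspace A"
  and matrix_algebra_mult: "matrix_algebra A \<Longrightarrow> x \<in> A \<Longrightarrow> y \<in> A \<Longrightarrow> x ** y \<in> A"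
  by (simp_all add: matrix_algebra_def)

lemma mprod_in_algebra:
  assumes "matrix_algebra A" "xs \<noteq> []" "set xs \<subseteq> A"
  shows "mprod xs \<in> A"
  using assms(2,3)
proof (induction xs)
  case (Cons x xs)
  then show ?case
    using matrix_algebra_mult[OF assms(1)] by (cases "xs = []") simp_all
qed simp

lemma mpow_in_algebra:
  assumes "matrix_algebra A" "b \<in> A" "j \<ge> 1"
  shows "mpow b j \<in> A"
  using mprod_in_algebra[OF assms(1), of "replicate j b"] assms(2,3)
  by (auto simp: mprod_replicate)

lemma span_mult_closed:
  fixes X Y Z :: "(complex^'m^'m) set"
  assumes "\<And>x y. x \<in> X \<Longrightarrow> y \<in> Y \<Longrightarrow> x ** y \<in> span Z"
  assumes "x \<in> span X" "y \<in> span Y"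
  shows "x ** y \<in> span Z"
  using assms(2)
proof (induction rule: span_induct)
  case base
  show ?case
    by (auto simp: subspace_def matrix_mul_simps intro: span_add span_scale span_zero)
next
  case (step x)
  show ?case
    using assms(3)
  proof (induction rule: span_induct)
    case base
    show ?case
      by (auto simp: subspace_def matrix_mul_simps intro: span_add span_scale span_zero)
  next
    case (step y)
    with \<open>x \<in> X\<close> show ?case by (rule assms(1))
  qed
qed

text \<open>Fitting: the decreasing spans of the powers \<open>b ^ i\<close>, \<open>i \<ge> j\<close>, stabilise at some \<open>a\<close>, where
  \<open>b ^ a = b ^ a h\<close> with \<open>h\<close> a polynomial in \<open>b\<close> without constant term; then \<open>e = h ^ a\<close>.\<close>

lemma fitting_idempotent:
  fixes b :: "complex^'m^'m"
  assumes A: "matrix_algebra A" and b: "b \<in> A"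
  obtains e a where "e \<in> A" "e ** e = e" "b ** e = e ** b" "1 \<le> a" "mpow b a ** e = mpow b a"
proof -
  define S where "S j = span {mpow b i | i. i \<ge> j}" for j
  have S_mult: "x ** y \<in> S (i + j)" if "x \<in> S i" "y \<in> S j" for x y i j
    unfolding S_def
  proof (rule span_mult_closed[OF _ that[unfolded S_def]])
    fix x y assume "x \<in> {mpow b k | k. i \<le> k}" "y \<in> {mpow b k | k. j \<le> k}"
    then obtain k m where "i \<le> k" "x = mpow b k" "j \<le> m" "y = mpow b m" by blast
    then have "x ** y = mpow b (k + m)" "i + j \<le> k + m" by (simp_all add: mpow_add)
    then show "x ** y \<in> span {mpow b k | k. i + j \<le> k}" by (blast intro: span_base)
  qed
  have "\<exists>a\<ge>1. \<forall>j\<ge>1. dim (S a) \<le> dim (S j)"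
    using ex_has_least_nat[of "\<lambda>j. j \<ge> 1" 1 "\<lambda>j. dim (S j)"] by auto
  then obtain a where a: "a \<ge> 1" "\<And>j. j \<ge> 1 \<Longrightarrow> dim (S a) \<le> dim (S j)"
    by blast
  have "S (Suc a) = S a"
  proof (rule subspace_dim_equal)
    show "S (Suc a) \<subseteq> S a"
      unfolding S_def by (rule span_mono) auto
  qed (use a in \<open>auto simp: S_def\<close>)
  moreover have "mpow b a \<in> S a"
    unfolding S_def by (rule span_base) blast
  \<comment> \<open>A power with exponent above \<open>a\<close> is \<open>mpow b a\<close> times a
    power with positive exponent. As \<open>mpow b a\<close> lies in \<open>S a = S (Suc a)\<close>,
    it has the form \<open>mpow b a ** h\<close> with \<open>h\<close> in
    \<open>S 1\<close>.\<close>
  moreover have "S (Suc a) = (**) (mpow b a) ` S 1"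
  proof -
    have "{mpow b i | i. i \<ge> Suc a} = (**) (mpow b a) ` {mpow b i | i. i \<ge> 1}"
    proof (intro equalityI subsetI)
      fix x assume "x \<in> {mpow b i | i. i \<ge> Suc a}"
      then obtain i where "i \<ge> Suc a" "x = mpow b i" by blast
      then have "x = mpow b a ** mpow b (i - a)" "i - a \<ge> 1"
        by (auto simp flip: mpow_add)
      then show "x \<in> (**) (mpow b a) ` {mpow b i | i. i \<ge> 1}" by blast
    next
      fix x assume "x \<in> (**) (mpow b a) ` {mpow b i | i. i \<ge> 1}"
      then obtain i where "i \<ge> 1" "x = mpow b (a + i)" by (auto simp: mpow_add)
      moreover from this have "Suc a \<le> a + i" by simp
      ultimately show "x \<in> {mpow b i | i. i \<ge> Suc a}" by blast
    qed
    moreover have "linear ((**) (mpow b a) :: complex^'m^'m \<Rightarrow> _)"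
      by (rule linearI) (simp_all add: matrix_mul_simps)
    ultimately show ?thesis
      unfolding S_def by (simp only: span_linear_image)
  qed
  ultimately obtain h where h: "h \<in> S 1" "mpow b a ** h = mpow b a"
    by (metis imageE)
  have absorb: "y ** h = y" if "y \<in> S a" for y
    using that unfolding S_def
  proof (induction rule: span_induct)
    case base
    show ?case by (auto simp: subspace_def matrix_mul_simps)
  next
    case (step y)
    then obtain i where "i \<ge> a" "y = mpow b i" by blast
    then have "y = mpow b (i - a) ** mpow b a" by (simp flip: mpow_add)
    then show ?case by (simp add: h(2) flip: matrix_mul_assoc)
  qed
  have absorb': "y ** mpow h j = y" if "y \<in> S a" for y j
    by (induction j) (simp_all add: absorb that matrix_mul_assoc)
  have hS: "mpow h j \<in> S j" for j
  proof (induction j)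
    case 0
    show ?case unfolding S_def by (rule span_base) (metis (mono_tags, lifting) le0 mem_Collect_eq mpow_0)
  next
    case (Suc j)
    with S_mult[OF h(1) Suc] show ?case by simp
  qed
  have S1: "S 1 \<subseteq> A"
    unfolding S_def using matrix_algebra_subspace[OF A] b
    by (intro span_minimal) (auto intro: mpow_in_algebra[OF A])
  have Sa1: "S a \<subseteq> S 1"
    unfolding S_def using a by (intro span_mono) auto
  have comm: "b ** y = y ** b" if "y \<in> S 1" for y
    using that unfolding S_def
  proof (induction rule: span_induct)
    case base
    show ?case by (auto simp: subspace_def matrix_mul_simps)
  next
    case (step y)
    then obtain i where "y = mpow b i" by blast
    then show ?case
      using mpow_add[of b 1 i] mpow_add[of b i 1] by (simp add: add.commute)
  qed
  show ?thesis
  proof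
    show "mpow h a \<in> A" "b ** mpow h a = mpow h a ** b"
      using hS S1 Sa1 comm by blast+
    \<comment> \<open>\<open>mpow h a\<close> itself lies in \<open>S a\<close>, on which right
      multiplication by any power of \<open>h\<close> is the identity.\<close>
    show "mpow h a ** mpow h a = mpow h a"
      by (rule absorb') (rule hS)
    show "mpow b a ** mpow h a = mpow b a"
      by (rule absorb') (use \<open>mpow b a \<in> S a\<close> in simp)
  qed (use a in auto)
qed

section \<open>Nilpotency of algebras of traceless matrices\<close>

lemma traceless_algebra_nil:
  assumes A: "matrix_algebra A" and tr: "\<And>x. x \<in> A \<Longrightarrow> trace x = 0" and b: "b \<in> A"
  shows "\<exists>a. mpow b a = 0"
  \<comment> \<open>The Fitting idempotent \<open>e\<close> of \<open>b\<close> is traceless, hence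
    zero, so \<open>mpow b a = mpow b a ** e\<close> vanishes.\<close>
  using fitting_idempotent[OF A b] idempotent_trace_0 tr matrix_mul_zero_right by metis

text \<open>The step of Engel's theorem. Take \<open>v\<close> outside \<open>K\<close> with
  \<open>T v = A v + K\<close> of least dimension. If \<open>b *v v\<close> were outside
  \<open>K\<close>, minimality would give \<open>T (b *v v) = T v\<close>, so \<open>b *v v\<close>
  would be fixed modulo \<open>K\<close> by some nilpotent \<open>c\<close> in
  \<open>A\<close>.\<close>

lemma nil_algebra_stable_extension:
  fixes K :: "(complex^'m) set"
  assumes A: "matrix_algebra A" and nil: "\<And>b. b \<in> A \<Longrightarrow> \<exists>a. mpow b a = 0"
    and K: "subspace K" "K \<noteq> UNIV" and stable: "\<And>b v. b \<in> A \<Longrightarrow> v \<in> K \<Longrightarrow> b *v v \<in> K"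
  shows "\<exists>v. v \<notin> K \<and> (\<forall>b\<in>A. b *v v \<in> K)"
proof -
  define T where "T v = {b *v v + k | b k. b \<in> A \<and> k \<in> K}" for v
  have sub: "subspace (T v)" for v
  proof -
    have "T v = {x + y | x y. x \<in> (\<lambda>b. b *v v) ` A \<and> y \<in> K}"
      by (auto simp: T_def)
    moreover have "subspace ((\<lambda>b. b *v v) ` A)"
      using matrix_algebra_subspace[OF A] by (intro linear_subspace_image linearI)
        (simp_all add: algebra_simps matrix_vector_scaleR_left)
    ultimately show ?thesis
      using K by (simp add: subspace_sums)
  qed
  obtain u where "u \<notin> K" using K by blast
  then have "\<exists>v. v \<notin> K \<and> (\<forall>w. w \<notin> K \<longrightarrow> dim (T v) \<le> dim (T w))"
    using ex_has_least_nat[of "\<lambda>v. v \<notin> K" u "\<lambda>v. dim (T v)"] by auto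
  then obtain v where v: "v \<notin> K" "\<And>w. w \<notin> K \<Longrightarrow> dim (T v) \<le> dim (T w)"
    by blast
  have "b *v v \<in> K" if b: "b \<in> A" for b
  proof (rule ccontr)
    let ?w = "b *v v"
    assume w: "?w \<notin> K"
    have "T ?w \<subseteq> T v"
      using matrix_algebra_mult[OF A _ b] by (auto simp: T_def matrix_vector_mul_assoc)
    then have "T ?w = T v"
      using sub v(2)[OF w] by (intro subspace_dim_equal) auto
    moreover have "?w \<in> T v"
      unfolding T_def using b subspace_0[OF K(1)] by force
    ultimately obtain c k where c: "c \<in> A" "k \<in> K" "?w = c *v ?w + k"
      unfolding T_def by blast
    \<comment> \<open>Every power of \<open>c\<close> fixes \<open>?w\<close> modulo
      \<open>K\<close>; a vanishing power then puts \<open>?w\<close> into \<open>K\<close>.\<close>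
    have "?w - mpow c j *v ?w \<in> K" for j
    proof (induction j)
      case (Suc j)
      have "?w - mpow c (Suc j) *v ?w = c *v (?w - mpow c j *v ?w) + k"
        by (subst c(3)) (simp add: matrix_vector_mult_diff_distrib matrix_vector_mul_assoc matrix_mul_assoc)
      with stable[OF c(1) Suc] c(2) K(1) show ?case
        by (simp add: subspace_add)
    qed (use K in \<open>simp add: subspace_0\<close>)
    moreover obtain a where "mpow c a = 0" using nil c by blast
    ultimately have "?w \<in> K" by (metis diff_zero matrix_vector_mult_0)
    with w show False by simp
  qed
  with v(1) show ?thesis by blast
qed

text \<open>Stage \<open>j\<close> consists of the vectors killed by all products of
  \<open>j\<close> elements of \<open>A\<close>.\<close>

primrec annihilator_chain :: "(complex^'m^'m) set \<Rightarrow> nat \<Rightarrow> (complex^'m::finite) set" where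
  "annihilator_chain A 0 = {0}"
| "annihilator_chain A (Suc j) = {v. \<forall>b\<in>A. b *v v \<in> annihilator_chain A j}"

lemma annihilator_chain_mono: "annihilator_chain A j \<subseteq> annihilator_chain A (Suc j)"
  by (induction j) auto

lemma subspace_annihilator_chain: "vec.subspace (annihilator_chain A j)"
proof (induction j)
  case 0
  show ?case by (simp add: vec.subspace_0 vec.subspace_def)
next
  case (Suc j)
  then show ?case
    by (auto simp: vec.subspace_def matrix_vector_right_distrib vector_scalar_commute)
qed

text \<open>The Engel step makes the chain grow strictly until it fills the space. Dimensions are
  counted over the complex numbers, so that \<open>CARD('m)\<close> stages suffice; real dimensions
  would allow twice as many.\<close>

lemma dim_annihilator_chain:
  fixes A :: "(complex^'m^'m) set"
  assumes A: "matrix_algebra A" and nil: "\<And>b. b \<in> A \<Longrightarrow> \<exists>a. mpow b a = 0"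
  shows "min j CARD('m) \<le> vec.dim (annihilator_chain A j)"
proof (induction j)
  case (Suc j)
  let ?K = "annihilator_chain A"
  show ?case
  proof (cases "?K j = UNIV")
    case True
    then show ?thesis
      using annihilator_chain_mono[of A j] by (simp add: vec_dim_card card_cart_basis top.extremum_unique)
  next
    case False
    \<comment> \<open>The Engel step is formulated for real subspaces, whereas the growth is
      measured by complex dimension.\<close>
    have "subspace (?K j)"
      using subspace_annihilator_chain[of A j]
      by (auto simp: vec.subspace_def subspace_def scaleR_vec_def vector_scalar_mult_def scaleR_conv_of_real)
    then have "\<exists>v. v \<notin> ?K j \<and> (\<forall>b\<in>A. b *v v \<in> ?K j)"
      using annihilator_chain_mono[of A j] False
      by (intro nil_algebra_stable_extension[OF A nil]) auto
    then have "?K j \<subset> ?K (Suc j)"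
      using annihilator_chain_mono[of A j] by auto
    then have "vec.dim (?K j) < vec.dim (?K (Suc j))"
      using subspace_annihilator_chain vec.dim_psubset vec.span_eq_iff by metis
    with Suc show ?thesis by linarith
  qed
qed simp

lemma mprod_annihilator_chain:
  assumes "set xs \<subseteq> A" "v \<in> annihilator_chain A (j + length xs)"
  shows "mprod xs *v v \<in> annihilator_chain A j"
  using assms
proof (induction xs arbitrary: j)
  case (Cons x xs)
  then have "mprod xs *v v \<in> annihilator_chain A (Suc j)"
    using Cons.IH[of "Suc j"] by simp
  with Cons.prems have "x *v (mprod xs *v v) \<in> annihilator_chain A j" by simp
  then show ?case by (simp add: matrix_vector_mul_assoc)
qed simp

lemma nil_algebra_nilpotent:
  fixes A :: "(complex^'m^'m) set"
  assumes A: "matrix_algebra A" and nil: "\<And>b. b \<in> A \<Longrightarrow> \<exists>a. mpow b a = 0"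
    and xs: "set xs \<subseteq> A" "length xs = CARD('m)"
  shows "mprod xs = 0"
proof -
  let ?K = "annihilator_chain A (CARD('m))"
  have "vec.dim ?K = CARD('m)"
    using dim_annihilator_chain[OF A nil, of "CARD('m)"] vec.dim_subset_UNIV[of ?K]
    by (simp add: vec.dimension_def card_cart_basis)
  then have "?K = UNIV"
    by (metis subspace_annihilator_chain vec.dim_eq_full vec.span_eq_iff card_cart_basis vec.dimension_def)
  then have "mprod xs *v v = 0" for v
    using mprod_annihilator_chain[OF xs(1), of v 0] xs(2) by simp
  then show ?thesis
    by (simp add: matrix_eq)
qed

section \<open>Matrix algebras with a multiplicative trace\<close>

locale augmented_algebra =
  fixes A :: "(complex^'m^'m) set" and E :: "complex^'m^'m"
  assumes algebra: "matrix_algebra A"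
    and trace_real: "x \<in> A \<Longrightarrow> trace x \<in> \<real>"
    and trace_mult: "x \<in> A \<Longrightarrow> y \<in> A \<Longrightarrow> trace (x ** y) = trace x * trace y"
    and E: "E \<in> A" "trace E = 1"
begin

text \<open>The kernel of the trace, which is a real-valued character of \<open>A\<close>. It is
  therefore an ideal, and itself an algebra of traceless matrices, to which the nilpotency result
  applies.\<close>

definition I where "I = {x \<in> A. trace x = 0}"

text \<open>The exponent is the length at which products from \<open>I\<close> vanish, so this power
  removes the part of \<open>E\<close> in \<open>I\<close> and leaves a rank-one idempotent.\<close>

definition P where "P = mpow E CARD('m)"

lemma A_closed:
  "x \<in> A \<Longrightarrow> y \<in> A \<Longrightarrow> x ** y \<in> A"
  "x \<in> A \<Longrightarrow> y \<in> A \<Longrightarrow> x - y \<in> A"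
  "x \<in> A \<Longrightarrow> r *\<^sub>R x \<in> A"
  using algebra by (simp_all add: matrix_algebra_def subspace_diff subspace_scale)

lemma I_ideal:
  "x \<in> I \<Longrightarrow> y \<in> A \<Longrightarrow> x ** y \<in> I"
  "x \<in> A \<Longrightarrow> y \<in> I \<Longrightarrow> x ** y \<in> I"
  by (auto simp: I_def A_closed trace_mult)

lemma I_diff: "x \<in> I \<Longrightarrow> y \<in> I \<Longrightarrow> x - y \<in> I"
  by (auto simp: I_def A_closed trace_sub)

lemma I_subset: "x \<in> I \<Longrightarrow> x \<in> A"
  by (simp add: I_def)

lemma algebra_I: "matrix_algebra I"
  using algebra
  by (simp add: I_def matrix_algebra_def subspace_def trace_add trace_scaleR trace_zero trace_mult)

lemma I_nilpotent: "set xs \<subseteq> I \<Longrightarrow> length xs = CARD('m) \<Longrightarrow> mprod xs = 0"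
  by (rule nil_algebra_nilpotent[OF algebra_I])
    (auto intro: traceless_algebra_nil[OF algebra_I] simp: I_def)

lemma trace_mpow_E: "trace (mpow E j) = 1" if "j \<ge> 1"
  using that
proof (induction j rule: dec_induct)
  case (step j)
  then show ?case
    using trace_mult[OF E(1) mpow_in_algebra[OF algebra E(1)], of j] E(2) by simp
qed (simp add: E(2))

text \<open>The Fitting idempotent \<open>e\<close> of \<open>E\<close> is nonzero, so its trace is
  a nonzero root of \<open>t = t * t\<close>, namely 1. Being of rank one and commuting with
  \<open>E\<close>, it satisfies \<open>E e = e E = e\<close>. Finally \<open>E - e\<close> lies in
  \<open>I\<close>, and its power of exponent \<open>CARD('m)\<close> is both 0 and
  \<open>P - e\<close>.\<close>

lemma P_projector:
  shows P_in: "P \<in> A" and P_idem: "P ** P = P" and trace_P: "trace P = 1"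
proof -
  obtain e a where e: "e \<in> A" "e ** e = e" "E ** e = e ** E" "1 \<le> a" "mpow E a ** e = mpow E a"
    using fitting_idempotent[OF algebra E(1)] by blast
  have "e \<noteq> 0"
    using e(4,5) trace_mpow_E[of a] by (auto simp: matrix_mul_zero_right trace_zero)
  then have "trace e \<noteq> 0"
    using idempotent_trace_0 e(2) by blast
  then have e1: "trace e = 1"
    using trace_mult[OF e(1) e(1)] e(2) by simp
  have "e ** E ** e = e"
    using trace_mult[OF e(1) E(1)] e1 E(2)
    by (simp add: idempotent_trace_1[OF e(2) e1] vec_eq_iff)
  moreover have "e ** E ** e = E ** (e ** e)"
    by (simp add: matrix_mul_assoc e(3))
  ultimately have Ee: "E ** e = e" "e ** E = e"
    using e(2,3) by simp_all
  \<comment> \<open>All mixed terms collapse to \<open>e\<close>. The exponent must be positive,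
    since the zeroth power is \<open>mat 1\<close> on both sides.\<close>
  have diff: "mpow (E - e) j = mpow E j - e" if "j \<ge> 1" for j
    using that
  proof (induction j rule: dec_induct)
    case (step j)
    have "e ** mpow E j = e"
      by (induction j) (simp_all add: Ee matrix_mul_assoc)
    with step show ?case
      by (simp add: matrix_mul_simps Ee e(2))
  qed simp
  have "E - e \<in> I"
    by (simp add: I_def A_closed E e1 e(1) trace_sub)
  then have "mpow (E - e) CARD('m) = 0"
    using I_nilpotent[of "replicate CARD('m) (E - e)"] by (simp add: mprod_replicate set_replicate_conv_if)
  then have "P = e"
    using diff[of "CARD('m)"] by (simp add: P_def)
  with e e1 show "P \<in> A" "P ** P = P" "trace P = 1" by auto
qed

lemma P_sandwich: "P ** x ** P = Re (trace x) *\<^sub>R P" if "x \<in> A"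
proof -
  have "trace (P ** x) = of_real (Re (trace x))"
    using trace_mult[OF P_in that] trace_real[OF that] by (simp add: trace_P)
  then show ?thesis
    by (simp only: idempotent_trace_1[OF P_idem trace_P])
      (simp add: vec_eq_iff scaleR_conv_of_real[where 'a = complex])
qed

lemma P_sandwich_I: "x \<in> I \<Longrightarrow> P ** x ** P = 0"
  using P_sandwich[of x] by (simp add: I_def)

text \<open>The component of \<open>x\<close> in \<open>I\<close> when \<open>A\<close> is
  decomposed into the real multiples of \<open>P\<close> and the ideal \<open>I\<close>.\<close>

definition nilpart where "nilpart x = x - Re (trace x) *\<^sub>R P"

lemma nilpart_in: "x \<in> A \<Longrightarrow> nilpart x \<in> I"
  using trace_real[of x]
  by (simp add: nilpart_def I_def A_closed P_in trace_sub trace_scaleR trace_P scaleR_conv_of_real[where 'a = complex])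

lemma mprod_I_absorb:
  assumes "set xs \<subseteq> I" "y \<in> I"
  shows "mprod xs ** y \<in> I"
  using assms by (induction xs) (simp_all add: I_ideal(2) I_subset flip: matrix_mul_assoc)

lemma mprod_I_absorb':
  assumes "set xs \<subseteq> I" "y \<in> I"
  shows "y ** mprod xs \<in> I"
  using assms by (induction xs arbitrary: y) (simp_all add: I_ideal(2) I_subset matrix_mul_assoc)

lemma I_complement:
  assumes "x \<in> I"
  shows "(mat 1 - P) ** x \<in> I" "x ** (mat 1 - P) \<in> I"
  using assms by (simp_all add: matrix_mul_simps I_diff I_ideal P_in)

text \<open>Since \<open>P x P = 0\<close> for all \<open>x\<close> in the ideal \<open>I\<close>, the components of the factors along \<open>P\<close> drop
  out of a product that stands to the left of \<open>(1 - P) y P\<close> with \<open>y\<close> in \<open>I\<close>.\<close>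

lemma left_word_annihilates:
  assumes "set xs \<subseteq> A" "length xs = CARD('m)" "y \<in> I"
  shows "mprod xs ** ((mat 1 - P) ** y ** P) = 0"
proof -
  let ?z = "(mat 1 - P) ** y"
  have "mprod xs ** (?z ** P) = mprod (map nilpart xs) ** (?z ** P)" if "set xs \<subseteq> A" for xs
    using that
  proof (induction xs)
    case (Cons x xs)
    have "P ** (mprod (map nilpart xs) ** ?z) ** P = 0"
      using Cons.prems by (intro P_sandwich_I mprod_I_absorb I_complement assms) (auto intro: nilpart_in)
    then have "P ** (mprod (map nilpart xs) ** (?z ** P)) = 0"
      by (simp add: matrix_mul_assoc)
    then have "x ** (mprod (map nilpart xs) ** (?z ** P)) = nilpart x ** (mprod (map nilpart xs) ** (?z ** P))"
      by (simp add: nilpart_def matrix_mul_diff_left matrix_mul_scaleR_left)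
    with Cons show ?case
      by (simp flip: matrix_mul_assoc)
  qed simp
  moreover have "mprod (map nilpart xs) = 0"
    using assms by (intro I_nilpotent) (auto intro: nilpart_in)
  ultimately show ?thesis
    using assms by (simp add: matrix_mul_zero_left)
qed

text \<open>With \<open>mprod xs ** (mat 1 - P)\<close> on the left, the letters of
  \<open>ys\<close> may be replaced one by one by their parts in \<open>I\<close>: the multiple of
  \<open>P\<close> in each letter contributes nothing. The resulting product of
  \<open>CARD('m)\<close> elements of \<open>I\<close> is zero.\<close>

lemma mprod_insert_P:
  assumes xs: "set xs \<subseteq> A" "length xs = CARD('m)" and ys: "set ys \<subseteq> A" "length ys = CARD('m)"
  shows "mprod xs ** mprod ys = mprod xs ** P ** mprod ys"
proof -
  let ?u = "mprod xs ** (mat 1 - P)"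
  have "?u ** mprod zs = ?u ** mprod (map nilpart zs)" if "set zs \<subseteq> A" for zs
    using that
  proof (induction zs rule: rev_induct)
    case (snoc z zs)
    let ?w = "mprod (map nilpart zs)"
    \<comment> \<open>For an empty prefix this is \<open>(mat 1 - P) ** P = 0\<close>; otherwise
      \<open>?w\<close> lies in \<open>I\<close> and \<open>left_word_annihilates\<close>
      applies.\<close>
    have "?u ** ?w ** P = 0"
    proof (cases zs)
      case Nil
      then show ?thesis by (simp add: matrix_mul_simps P_idem flip: matrix_mul_assoc)
    next
      case (Cons z' zs')
      have "?w \<in> I"
        unfolding Cons using snoc.prems Cons
        by (auto intro!: mprod_I_absorb' nilpart_in)
      then show ?thesis
        using left_word_annihilates[OF xs] by (simp add: matrix_mul_assoc)
    qed
    then have "?u ** ?w ** z = ?u ** ?w ** nilpart z"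
      by (simp add: nilpart_def matrix_mul_diff_right matrix_mul_scaleR_right)
    with snoc show ?case
      by (simp add: mprod_append matrix_mul_assoc)
  qed simp
  moreover have "mprod (map nilpart ys) = 0"
    using ys by (intro I_nilpotent) (auto intro: nilpart_in)
  ultimately have "?u ** mprod ys = 0"
    using ys by (simp add: matrix_mul_zero_right)
  then show ?thesis
    by (simp add: matrix_mul_simps)
qed

end

subsection \<open>Words in a family of matrices\<close>

definition wprod :: "('p \<Rightarrow> 'p \<Rightarrow> complex^'m^'m) \<Rightarrow> 'p list \<Rightarrow> 'p list \<Rightarrow> complex^'m::finite^'m" where
  "wprod W ks is = mprod (map2 W ks is)"

lemma wprod_simps [simp]: "wprod W [] [] = mat 1"
  "wprod W (k # ks) (i # is) = W k i ** wprod W ks is"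
  by (simp_all add: wprod_def)

lemma wprod_append:
  "length ks = length is \<Longrightarrow> wprod W (ks @ ks') (is @ is') = wprod W ks is ** wprod W ks' is'"
  by (simp add: wprod_def mprod_append)

definition average :: "'p set \<Rightarrow> ('p \<Rightarrow> 'p \<Rightarrow> complex^'m^'m) \<Rightarrow> complex^'m::finite^'m" where
  "average L W = (1 / real (card L)) *\<^sub>R (\<Sum>i\<in>L. W i i)"

text \<open>Simplicity of the tensor blocked \<open>n\<close> times, stated for plain products of
  the letters. The fermionic signs of blocking are restored in
  \<open>simple_tensor_blocked\<close>.\<close>

definition simple_words :: "'p set \<Rightarrow> ('p \<Rightarrow> 'p \<Rightarrow> complex^'m^'m) \<Rightarrow> nat \<Rightarrow> bool" where
  "simple_words L W n \<longleftrightarrow> (let P = mpow (average L W) n; C = {ks. length ks = n \<and> set ks \<subseteq> L} in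
     P ** P = P \<and>
     (\<forall>k\<in>C. \<forall>i\<in>C. P ** wprod W k i ** P = (if k = i then P else 0)) \<and>
     (\<forall>k\<in>C. \<forall>i\<in>C. \<forall>k'\<in>C. \<forall>i'\<in>C.
        wprod W k i ** wprod W k' i' = wprod W k i ** P ** wprod W k' i'))"

text \<open>The span of the words is an augmented algebra with the averaged letter as
  \<open>E\<close>, so that \<open>P\<close> is the transfer matrix of the blocked words and the
  sandwich and insertion results give the conditions.\<close>

lemma simple_words_if_traces:
  fixes W :: "'p \<Rightarrow> 'p \<Rightarrow> complex^'m^'m"
  assumes L: "finite L" "L \<noteq> {}"
    and tr: "\<And>ks is. ks \<noteq> [] \<Longrightarrow> length ks = length is \<Longrightarrow> set ks \<subseteq> L \<Longrightarrow> set is \<subseteq> L \<Longrightarrow>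
      trace (wprod W ks is) = (if ks = is then 1 else 0)"
  shows "simple_words L W CARD('m)"
proof -
  let ?E = "average L W"
  \<comment> \<open>The empty word is excluded: it is \<open>mat 1\<close>, whose trace is
    \<open>CARD('m)\<close> instead of 1.\<close>
  define G where "G = {wprod W ks is | ks is. ks \<noteq> [] \<and> length ks = length is \<and> set ks \<subseteq> L \<and> set is \<subseteq> L}"
  have GI: "wprod W ks is \<in> G" if "ks \<noteq> []" "length ks = length is" "set ks \<subseteq> L" "set is \<subseteq> L" for ks "is"
    using that unfolding G_def by blast
  \<comment> \<open>Concatenated words of matching lengths agree exactly if both parts agree, so the
    0-1 traces multiply.\<close>
  have GG: "x ** y \<in> G \<and> trace (x ** y) = trace x * trace y" if xy: "x \<in> G" "y \<in> G" for x y
  proof -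
    from xy obtain ks "is" ks' is' where
      x: "x = wprod W ks is" "ks \<noteq> []" "length ks = length is" "set ks \<subseteq> L" "set is \<subseteq> L" and
      y: "y = wprod W ks' is'" "ks' \<noteq> []" "length ks' = length is'" "set ks' \<subseteq> L" "set is' \<subseteq> L"
      unfolding G_def by blast
    have "x ** y = wprod W (ks @ ks') (is @ is')"
      by (simp add: x y wprod_append)
    moreover have "trace x = (if ks = is then 1 else 0)" "trace y = (if ks' = is' then 1 else 0)"
      using x y tr by blast+
    ultimately show ?thesis
      using x y by (auto intro!: GI simp: tr)
  qed
  have single: "W k i \<in> G" if "k \<in> L" "i \<in> L" for k i
    using GI[of "[k]" "[i]"] that by simp
  have single_tr: "trace (W k i) = (if k = i then 1 else 0)" if "k \<in> L" "i \<in> L" for k i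
    using tr[of "[k]" "[i]"] that by simp
  interpret augmented_algebra "span G" ?E
  proof
    have "x ** y \<in> span G" if "x \<in> span G" "y \<in> span G" for x y
      by (rule span_mult_closed[OF _ that]) (simp add: GG span_base)
    then show "matrix_algebra (span G)"
      by (simp add: matrix_algebra_def)
  next
    fix x assume "x \<in> span G"
    then show "trace x \<in> \<real>"
    proof (induction rule: span_induct)
      case base
      show ?case by (auto simp: subspace_def trace_add trace_scaleR trace_zero scaleR_conv_of_real[where 'a = complex])
    next
      case (step x)
      then show ?case by (auto simp: G_def tr)
    qed
  next
    fix x y assume "x \<in> span G" "y \<in> span G"
    then show "trace (x ** y) = trace x * trace y"
    proof (induction rule: span_induct)
      case base
      show ?case
        by (auto simp: subspace_def trace_add trace_scaleR trace_zero matrix_mul_simps algebra_simps)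
    next
      case (step x)
      from \<open>y \<in> span G\<close> show ?case
      proof (induction rule: span_induct)
        case base
        show ?case
          by (auto simp: subspace_def trace_add trace_scaleR trace_zero matrix_mul_simps algebra_simps)
      qed (use GG step in blast)
    qed
  next
    show "?E \<in> span G"
      unfolding average_def by (intro span_scale span_sum span_base single)
    show "trace ?E = 1"
      using L by (simp add: average_def trace_scaleR trace_sum single_tr scaleR_conv_of_real[where 'a = complex])
  qed
  have letters: "set (map2 W ks is) \<subseteq> span G" if "set ks \<subseteq> L" "set is \<subseteq> L" for ks "is"
    using that by (auto simp: set_zip intro!: span_base single dest: nth_mem)
  show ?thesis
    unfolding simple_words_def Let_def P_def[symmetric]
  proof (safe intro!: P_idem)
    fix ks "is"
    assume "length ks = CARD('m)" "length is = CARD('m)" and "set ks \<subseteq> L" "set is \<subseteq> L"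
    moreover from this have "ks \<noteq> []" by auto
    ultimately show "P ** wprod W ks is ** P = (if ks = is then P else 0)"
      using tr[of ks "is"] by (subst P_sandwich) (auto intro!: span_base GI)
  next
    fix k i k' i'
    assume "length k = CARD('m)" "length i = CARD('m)" "length k' = CARD('m)" "length i' = CARD('m)"
      and "set k \<subseteq> L" "set i \<subseteq> L" "set k' \<subseteq> L" "set i' \<subseteq> L"
    then show "wprod W k i ** wprod W k' i' = wprod W k i ** P ** wprod W k' i'"
      unfolding wprod_def by (intro mprod_insert_P letters) simp_all
  qed
qed

lemma wprod_commute:
  assumes "\<And>k i. k \<in> L \<Longrightarrow> i \<in> L \<Longrightarrow> Q ** W k i = W k i ** Q"
    and "length ks = length is" "set ks \<subseteq> L" "set is \<subseteq> L"
  shows "Q ** wprod W ks is = wprod W ks is ** Q"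
  using assms(2-)
proof (induction ks "is" rule: list_induct2)
  case (Cons k ks i "is")
  then show ?case
    using assms(1)[of k i] by (simp add: matrix_mul_assoc) (simp flip: matrix_mul_assoc)
qed simp

text \<open>The matrices \<open>F\<close> and \<open>R\<close> generate a Clifford algebra commuting with all the \<open>W k i\<close>, and
  \<open>F\<close> exchanges the eigenspaces of \<open>R\<close>. Hence the words restrict to the eigenspace of \<open>R\<close> for the
  eigenvalue 1 with half their trace, and an identity between words holds
  as soon as it holds on this eigenspace.\<close>

lemma simple_words_if_doubled_traces:
  fixes W :: "'p \<Rightarrow> 'p \<Rightarrow> complex^'m^'m"
  assumes L: "finite L" "L \<noteq> {}"
    and tr: "\<And>ks is. ks \<noteq> [] \<Longrightarrow> length ks = length is \<Longrightarrow> set ks \<subseteq> L \<Longrightarrow> set is \<subseteq> L \<Longrightarrow>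
      trace (wprod W ks is) = (if ks = is then 2 else 0)"
    and F: "\<And>k i. k \<in> L \<Longrightarrow> i \<in> L \<Longrightarrow> F ** W k i = W k i ** F"
    and R: "\<And>k i. k \<in> L \<Longrightarrow> i \<in> L \<Longrightarrow> R ** W k i = W k i ** R"
    and RR: "R ** R = mat 1" and FF: "F ** F = - mat 1" and FR: "F ** R = - (R ** F)"
  shows "simple_words L W CARD('m)"
proof -
  \<comment> \<open>The projection onto the eigenspace of \<open>R\<close> for the eigenvalue 1. The
    letters \<open>p ** W k i\<close> are kept as matrices of full size, so the word length
    \<open>CARD('m)\<close> does not change.\<close>
  define p where "p = (1/2) *\<^sub>R (mat 1 + R)"
  let ?V = "\<lambda>k i. p ** W k i"
  have pp: "p ** p = p"
    by (simp add: p_def matrix_mul_simps RR) (simp add: algebra_simps flip: scaleR_add_left)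
  have pW: "p ** W k i = W k i ** p" if "k \<in> L" "i \<in> L" for k i
    using R[OF that] by (simp add: p_def matrix_mul_simps)
  have pw: "p ** wprod W ks is = wprod W ks is ** p"
    if "length ks = length is" "set ks \<subseteq> L" "set is \<subseteq> L" for ks "is"
    using that by (intro wprod_commute[of L] pW)
  have Vw: "wprod ?V ks is = p ** wprod W ks is"
    if "ks \<noteq> []" "length ks = length is" "set ks \<subseteq> L" "set is \<subseteq> L" for ks "is"
    using that(2,1,3,4)
  proof (induction ks "is" rule: list_induct2)
    case (Cons k ks i "is")
    show ?case
    proof (cases ks)
      case Nil
      with Cons show ?thesis by simp
    next
      case (Cons k' ks')
      have "p ** W k i ** (p ** wprod W ks is) = p ** (p ** W k i) ** wprod W ks is"
        using pW[of k i] Cons.prems by (simp add: matrix_mul_assoc)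
      then show ?thesis
        using Cons.IH Cons.prems Cons by (simp add: matrix_mul_assoc pp)
    qed
  qed simp
  have trR: "trace (R ** wprod W ks is) = 0"
    if "length ks = length is" "set ks \<subseteq> L" "set is \<subseteq> L" for ks "is"
  proof -
    let ?w = "wprod W ks is"
    have "F ** ?w = ?w ** F"
      using that by (intro wprod_commute[of L] F)
    \<comment> \<open>Moving one \<open>F\<close> around cyclically turns this trace into that of
      \<open>R ** ?w\<close>, while \<open>F ** F = - mat 1\<close> turns it into the negative.
      Hence \<open>p\<close> halves the traces of words.\<close>
    then have "trace (R ** ?w ** F ** F) = trace (F ** R ** F ** ?w)"
      by (metis trace_mul_sym matrix_mul_assoc)
    also have "F ** R ** F = R"
      by (simp add: FR matrix_mul_simps flip: matrix_mul_assoc) (simp add: FF matrix_mul_simps)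
    also have "R ** ?w ** F ** F = - (R ** ?w)"
      by (simp flip: matrix_mul_assoc) (simp add: FF matrix_mul_simps)
    finally show ?thesis
      by (simp add: trace_def sum_negf)
  qed
  have V: "simple_words L ?V CARD('m)"
  proof (rule simple_words_if_traces[OF L])
    fix ks "is"
    assume a: "ks \<noteq> []" "length ks = length is" "set ks \<subseteq> L" "set is \<subseteq> L"
    then show "trace (wprod ?V ks is) = (if ks = is then 1 else 0)"
      using tr[OF a] trR[OF a(2-)]
      by (simp only: Vw[OF a]) (simp add: p_def matrix_mul_simps trace_scaleR trace_add scaleR_conv_of_real[where 'a = complex])
  qed
  let ?E = "average L W" and ?n = "CARD('m)"
  let ?P = "mpow ?E ?n"
  have pE: "p ** ?E = ?E ** p"
    unfolding average_def by (simp add: matrix_mul_simps matrix_mul_sum_left matrix_mul_sum_right pW)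
  have FE: "F ** ?E = ?E ** F"
    unfolding average_def by (simp add: matrix_mul_simps matrix_mul_sum_left matrix_mul_sum_right F)
  have avV: "average L ?V = p ** ?E"
    unfolding average_def by (simp add: matrix_mul_simps matrix_mul_sum_right)
  have mpow_comm: "q ** mpow ?E j = mpow ?E j ** q" if "q ** ?E = ?E ** q" for q j
  proof (induction j)
    case (Suc j)
    have "q ** (?E ** mpow ?E j) = ?E ** (q ** mpow ?E j)"
      by (simp add: matrix_mul_assoc that)
    with Suc show ?case by (simp add: matrix_mul_assoc)
  qed simp
  have PV: "mpow (p ** ?E) j = p ** mpow ?E j" if "j \<ge> 1" for j
    using that
  proof (induction j rule: dec_induct)
    case (step j)
    have "p ** ?E ** (p ** mpow ?E j) = p ** (p ** ?E) ** mpow ?E j"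
      using pE by (simp add: matrix_mul_assoc)
    with step show ?case by (simp add: matrix_mul_assoc pp)
  qed simp
  \<comment> \<open>\<open>F\<close> is invertible and satisfies \<open>F p = (1 - p) F\<close>, so
    it carries the identity from the range of \<open>p\<close> to the complementary
    eigenspace.\<close>
  have lift: "X = Y" if eq: "p ** X = p ** Y" and X: "F ** X = X ** F" and Y: "F ** Y = Y ** F" for X Y
  proof -
    have FPi: "F ** p = (mat 1 - p) ** F"
    proof -
      have half: "F - (1/2::real) *\<^sub>R F = (1/2) *\<^sub>R F"
        by (simp add: vec_eq_iff)
      show ?thesis
        by (simp add: p_def matrix_mul_simps FR scaleR_add_right half flip: diff_diff_eq)
    qed
    have "(mat 1 - p) ** (X - Y) ** F = F ** (p ** (X - Y))"
      using FPi X Y by (simp add: matrix_mul_diff_right matrix_mul_diff_left matrix_mul_assoc)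
        (simp add: matrix_mul_diff_left flip: matrix_mul_assoc)
    then have "(mat 1 - p) ** (X - Y) ** F ** F = 0"
      using eq by (simp add: matrix_mul_simps)
    then have "(mat 1 - p) ** (X - Y) ** (F ** F) = 0"
      by (simp only: matrix_mul_assoc)
    then have "(mat 1 - p) ** (X - Y) = 0"
      by (simp add: FF matrix_mul_minus_right)
    with eq show ?thesis
      by (simp add: matrix_mul_simps)
  qed
  have Fw: "F ** wprod W ks is = wprod W ks is ** F"
    if "length ks = length is" "set ks \<subseteq> L" "set is \<subseteq> L" for ks "is"
    using that by (intro wprod_commute[of L] F)
  have FP: "F ** ?P = ?P ** F" and pP: "p ** ?P = ?P ** p"
    using FE pE by (auto intro: mpow_comm)
  have pull: "(p ** X) ** (p ** Y) = p ** (X ** Y)" if "p ** X = X ** p" for X Y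
  proof -
    have "(p ** X) ** (p ** Y) = p ** (X ** p) ** Y"
      by (simp add: matrix_mul_assoc)
    also have "\<dots> = p ** p ** X ** Y"
      by (simp add: matrix_mul_assoc flip: that)
    finally show ?thesis
      by (simp add: pp matrix_mul_assoc)
  qed
  have commF: "F ** (X ** Y) = X ** Y ** F" if "F ** X = X ** F" "F ** Y = Y ** F" for X Y
    using that by (simp add: matrix_mul_assoc) (simp add: that flip: matrix_mul_assoc)
  have commp: "p ** (X ** Y) = X ** Y ** p" if "p ** X = X ** p" "p ** Y = Y ** p" for X Y
    using that by (simp add: matrix_mul_assoc) (simp add: that flip: matrix_mul_assoc)
  have ne: "ks \<noteq> []" if "length ks = CARD('m)" for ks :: "'p list"
    using that by auto
  have "mpow (average L ?V) ?n = p ** ?P"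
    unfolding avV by (rule PV) simp
  note V' = V[unfolded simple_words_def Let_def this]
  let ?C = "{ks. length ks = CARD('m) \<and> set ks \<subseteq> L}"
  have V1: "(p ** ?P) ** (p ** ?P) = p ** ?P"
    using V' by blast
  have V2: "(p ** ?P) ** wprod ?V k i ** (p ** ?P) = (if k = i then p ** ?P else 0)"
    if "k \<in> ?C" "i \<in> ?C" for k i
    using V' that by blast
  have V3: "wprod ?V k i ** wprod ?V k' i' = wprod ?V k i ** (p ** ?P) ** wprod ?V k' i'"
    if "k \<in> ?C" "i \<in> ?C" "k' \<in> ?C" "i' \<in> ?C" for k i k' i'
    using V' that by blast
  have C: "wprod ?V k i = p ** wprod W k i" "p ** wprod W k i = wprod W k i ** p"
    "F ** wprod W k i = wprod W k i ** F" if "k \<in> ?C" "i \<in> ?C" for k i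
    using that Vw[OF ne] pw Fw by simp_all
  show ?thesis
    unfolding simple_words_def Let_def
  proof (intro conjI ballI)
    show "?P ** ?P = ?P"
      using V1 unfolding pull[OF pP] by (rule lift) (rule commF[OF FP FP] FP)+
  next
    fix k i
    assume k: "k \<in> ?C" "i \<in> ?C"
    let ?w = "wprod W k i"
    have "p ** (?P ** ?w ** ?P) = (if k = i then p ** ?P else 0)"
      using V2[OF k] unfolding C(1)[OF k] pull[OF pP] pull[OF commp[OF pP C(2)[OF k]]] .
    also have "\<dots> = p ** (if k = i then ?P else 0)"
      by (simp add: matrix_mul_zero_right)
    finally show "?P ** ?w ** ?P = (if k = i then ?P else 0)"
    proof (rule lift)
      show "F ** (?P ** ?w ** ?P) = ?P ** ?w ** ?P ** F"
        by (rule commF[OF commF[OF FP C(3)[OF k]] FP])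
      show "F ** (if k = i then ?P else 0) = (if k = i then ?P else 0) ** F"
        by (simp add: FP matrix_mul_zero_left matrix_mul_zero_right)
    qed
  next
    fix k i k' i'
    assume k: "k \<in> ?C" "i \<in> ?C" and k': "k' \<in> ?C" "i' \<in> ?C"
    have "p ** (wprod W k i ** wprod W k' i') = p ** (wprod W k i ** ?P ** wprod W k' i')"
      using V3[OF k k']
      unfolding C(1)[OF k] C(1)[OF k'] pull[OF C(2)[OF k]] pull[OF commp[OF C(2)[OF k] pP]] .
    then show "wprod W k i ** wprod W k' i' = wprod W k i ** ?P ** wprod W k' i'"
      by (rule lift) (rule commF[OF C(3)[OF k] C(3)[OF k']] commF[OF commF[OF C(3)[OF k] FP] C(3)[OF k']])+
  qed
qed

subsection \<open>Kronecker products\<close>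

lemma kron_mult: "kron A B ** kron C D = kron (A ** C) (B ** D)"
proof -
  have "(kron A B ** kron C D) $ i $ j = kron (A ** C) (B ** D) $ i $ j" for i j
    unfolding kron_def matrix_matrix_mult_def
    by (simp add: sum_product UNIV_Times_UNIV[symmetric] sum.cartesian_product mult_ac
        case_prod_unfold del: UNIV_Times_UNIV)
  then show ?thesis
    by (simp add: vec_eq_iff)
qed

lemma kron_one: "kron (mat 1) (mat 1) = mat 1"
  by (auto simp: vec_eq_iff kron_def mat_def)

lemma kron_scaleR_left: "kron (r *\<^sub>R A) B = r *\<^sub>R kron A B"
  and kron_scaleR_right: "kron A (r *\<^sub>R B) = r *\<^sub>R kron A B"
  and kron_minus_left: "kron (- A) B = - kron A B"
  and kron_minus_right: "kron A (- B) = - kron A B"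
  by (simp_all add: vec_eq_iff kron_def)

lemma trace_kron: "trace (kron A B) = trace A * trace B"
  unfolding trace_def kron_def
  by (simp add: sum_product UNIV_Times_UNIV[symmetric] sum.cartesian_product case_prod_unfold del: UNIV_Times_UNIV)

definition cnj_mat :: "complex^'n^'m \<Rightarrow> complex^'n^'m" where
  "cnj_mat A = (\<chi> i j. cnj (A $ i $ j))"

lemma cnj_mat_mult: "cnj_mat (A ** B) = cnj_mat A ** cnj_mat B"
  by (simp add: vec_eq_iff cnj_mat_def matrix_matrix_mult_def)

lemma cnj_mat_scaleR: "cnj_mat (r *\<^sub>R A) = r *\<^sub>R cnj_mat A"
  by (simp add: vec_eq_iff cnj_mat_def)

lemma cnj_mat_one: "cnj_mat (mat 1) = mat 1"
  by (simp add: vec_eq_iff cnj_mat_def mat_def)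

lemma trace_cnj_mat: "trace (cnj_mat A) = cnj (trace A)"
  by (simp add: trace_def cnj_mat_def)

subsection \<open>Blocked tensors\<close>

lemma Zmat_sq: "Zmat T ** Zmat T = mat 1"
proof -
  have "(\<Sum>k\<in>UNIV. Zmat T $ i $ k * Zmat T $ k $ j) = (if i = j then 1 else 0)" for i j
  proof -
    have "(\<Sum>k\<in>UNIV. Zmat T $ i $ k * Zmat T $ k $ j) =
        (\<Sum>k\<in>UNIV. if k = i then Zmat T $ i $ i * Zmat T $ i $ j else 0)"
      by (rule sum.cong) (auto simp: Zmat_def)
    then show ?thesis
      by (simp add: Zmat_def flip: power_mult_distrib)
  qed
  then show ?thesis
    by (simp add: matrix_matrix_mult_def vec_eq_iff mat_def)
qed

lemma cnj_Zmat: "cnj_mat (Zmat T) = Zmat T"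
  by (simp add: vec_eq_iff cnj_mat_def Zmat_def)

lemma mpow_Zmat: "mpow (Zmat T) n = (if even n then mat 1 else Zmat T)"
  by (induction n) (auto simp: Zmat_sq)

lemma mpow_Zmat_nth: "mpow (Zmat T) n $ i $ j = (if i = j then (- 1) ^ (apar T i * n) else 0)"
  unfolding mpow_Zmat by (auto simp: Zmat_def mat_def minus_one_power_iff)

text \<open>The sign depends on the auxiliary column index only, so it is right multiplication of
  the conjugated layer by a power of \<open>Z\<close>. Later sign computations then need no
  auxiliary indices.\<close>

lemma double_ent_kron:
  "double_ent T k i =
    (\<Sum>j\<in>labels T. kron (cnj_mat (ent T j k) ** mpow (Zmat T) (par T k + par T i)) (ent T j i))"
proof -
  have "(cnj_mat (ent T j k) ** mpow (Zmat T) n) $ \<alpha> $ \<beta> = (- 1) ^ (apar T \<beta> * n) * cnj (ent T j k $ \<alpha> $ \<beta>)"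
    for j n \<alpha> \<beta>
  proof -
    have "cnj_mat (ent T j k) $ \<alpha> $ \<epsilon> * mpow (Zmat T) n $ \<epsilon> $ \<beta> =
        (if \<epsilon> = \<beta> then (- 1) ^ (apar T \<beta> * n) * cnj (ent T j k $ \<alpha> $ \<beta>) else 0)" for \<epsilon>
      by (simp add: mpow_Zmat_nth cnj_mat_def)
    then show ?thesis
      by (simp add: matrix_matrix_mult_def)
  qed
  then show ?thesis
    by (simp add: vec_eq_iff double_ent_def kron_def case_prod_unfold)
qed

lemma Zmat_ent:
  assumes "even_tensor T" "n \<in> labels T" "m \<in> labels T"
  shows "Zmat T ** ent T n m = (- 1 :: real) ^ (par T n + par T m) *\<^sub>R (ent T n m ** Zmat T)"
  using assms by (simp add: even_tensor_def)

lemma mpow_Zmat_cnj_ent: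
  assumes "even_tensor T" "n \<in> labels T" "m \<in> labels T"
  shows "mpow (Zmat T) q ** cnj_mat (ent T n m) =
    (- 1 :: real) ^ ((par T n + par T m) * q) *\<^sub>R (cnj_mat (ent T n m) ** mpow (Zmat T) q)"
proof -
  have "Zmat T ** cnj_mat (ent T n m) =
      (- 1 :: real) ^ (par T n + par T m) *\<^sub>R (cnj_mat (ent T n m) ** Zmat T)"
    using arg_cong[OF Zmat_ent[OF assms], of cnj_mat]
    by (simp add: cnj_mat_mult cnj_mat_scaleR cnj_Zmat)
  then show ?thesis
    by (cases "even q") (simp_all add: mpow_Zmat minus_one_power_iff)
qed

lemma block_simps [simp]:
  "labels (block T T') = labels T \<times> labels T'"
  "par (block T T') (n, p) = (par T n + par T' p) mod 2"
  "apar (block T T') = apar T"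
  "ent (block T T') (n, p) (m, q) = (- 1 :: real) ^ (par T m * (par T' p + par T' q)) *\<^sub>R (ent T n m ** ent T' p q)"
  by (simp_all add: block_def)

lemma cons_labels_simps [simp]:
  "labels (cons_labels T) = (\<lambda>x. fst x # snd x) ` labels T"
  "par (cons_labels T) (n # ns) = par T (n, ns)"
  "apar (cons_labels T) = apar T"
  "ent (cons_labels T) (n # ns) (m # ms) = ent T (n, ns) (m, ms)"
  by (simp_all add: cons_labels_def case_prod_unfold)

lemma Zmat_cong: "apar T = apar T' \<Longrightarrow> Zmat T = Zmat T'"
  by (auto simp: Zmat_def vec_eq_iff)

lemma minus_one_power_cong: "even m = even n \<Longrightarrow> (- 1 :: 'a::ring_1) ^ m = (- 1) ^ n"
  by (simp add: minus_one_power_iff)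

lemma even_tensor_block:
  assumes T: "even_tensor T" and T': "even_tensor T'" and apar: "apar T' = apar T"
  shows "even_tensor (block T T')"
proof -
  have Z: "Zmat (block T T') = Zmat T" "Zmat T' = Zmat T"
    using apar by (auto intro: Zmat_cong)
  have "Zmat T ** (ent T n m ** ent T' p q) =
      (- 1 :: real) ^ ((par T n + par T' p) mod 2 + (par T m + par T' q) mod 2) *\<^sub>R (ent T n m ** ent T' p q ** Zmat T)"
    if "n \<in> labels T" "m \<in> labels T" "p \<in> labels T'" "q \<in> labels T'" for n m p q
  proof -
    have "Zmat T ** (ent T n m ** ent T' p q) =
        (- 1 :: real) ^ (par T n + par T m) *\<^sub>R (ent T n m ** (Zmat T' ** ent T' p q))"
      using that by (simp add: Z matrix_mul_assoc Zmat_ent[OF T] matrix_mul_simps)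
    also have "\<dots> = (- 1 :: real) ^ (par T n + par T m + (par T' p + par T' q)) *\<^sub>R (ent T n m ** ent T' p q ** Zmat T)"
      unfolding Zmat_ent[OF T' that(3,4)] by (simp add: matrix_mul_simps matrix_mul_assoc power_add Z)
    also have "(- 1 :: real) ^ (par T n + par T m + (par T' p + par T' q)) =
        (- 1) ^ ((par T n + par T' p) mod 2 + (par T m + par T' q) mod 2)"
      by (rule minus_one_power_cong) auto
    finally show ?thesis .
  qed
  then show ?thesis
    using T T' by (auto simp: even_tensor_def Z matrix_mul_simps)
qed

lemma even_tensor_cons_labels:
  assumes "even_tensor T"
  shows "even_tensor (cons_labels T)"
proof -
  have Z: "Zmat (cons_labels T) = Zmat T"
    by (auto intro: Zmat_cong)
  show ?thesis
    using assms by (auto simp: even_tensor_def Z)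
qed

lemma apar_blocked [simp]: "apar (blocked T k) = apar T"
  by (cases k) simp_all

lemma even_tensor_blocked:
  assumes "even_tensor T"
  shows "even_tensor (blocked T k)"
proof (induction k)
  case 0
  show ?case using assms by (simp add: even_tensor_def)
next
  case (Suc k)
  then show ?case
    using assms by (simp add: even_tensor_cons_labels even_tensor_block)
qed

lemma labels_blocked: "labels (blocked T k) = {ks. length ks = k \<and> set ks \<subseteq> labels T}"
proof (induction k)
  case (Suc k)
  have "ks \<in> labels (blocked T (Suc k)) \<longleftrightarrow> length ks = Suc k \<and> set ks \<subseteq> labels T" for ks
    by (cases ks) (auto simp: Suc intro!: image_eqI[of _ _ "(hd ks, tl ks)"])
  then show ?case by blast
qed auto

lemma par_blocked: "par (blocked T (length ns)) ns = sum_list (map (par T) ns) mod 2"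
  by (induction ns) (simp_all add: mod_add_right_eq)

lemma double_ent_cons_labels:
  "double_ent (cons_labels T) (k # ks) (i # is) = double_ent T (k, ks) (i, is)"
proof -
  have inj: "inj_on (\<lambda>x. fst x # snd x) (labels T)"
    by (simp add: inj_on_def prod_eq_iff)
  have Z: "Zmat (cons_labels T) = Zmat T"
    by (auto intro: Zmat_cong)
  show ?thesis
    by (simp add: double_ent_kron sum.reindex[OF inj] Z)
qed

lemma matrix_mul_swap_middle:
  fixes A B C D :: "complex^'n^'n"
  assumes "B ** C = s *\<^sub>R (C ** B)"
  shows "A ** B ** (C ** D) = s *\<^sub>R (A ** C ** (B ** D))"
proof -
  have "A ** B ** (C ** D) = A ** (B ** C) ** D"
    by (simp add: matrix_mul_assoc)
  then show ?thesis
    by (simp add: assms matrix_mul_simps matrix_mul_assoc)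
qed

text \<open>Moving the power of \<open>Z\<close> of the first tensor past the conjugated matrix of
  the second costs a sign that depends on \<open>j'\<close>. The signs of blocking depend on
  \<open>j'\<close> in the same way, so what remains can be taken out of the sum.\<close>

lemma double_ent_block:
  assumes T': "even_tensor T'" and apar: "apar T' = apar T" and k': "k' \<in> labels T'"
  shows "double_ent (block T T') (k, k') (i, i') =
    (- 1 :: real) ^ (par T i * (par T' k' + par T' i')) *\<^sub>R (double_ent T k i ** double_ent T' k' i')"
proof -
  have Z: "Zmat (block T T') = Zmat T" "Zmat T' = Zmat T"
    using apar by (auto intro: Zmat_cong)
  let ?q = "par T k + par T i" and ?q' = "par T' k' + par T' i'"
  let ?c = "\<lambda>j. cnj_mat (ent T j k)" and ?c' = "\<lambda>j. cnj_mat (ent T' j k')"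
  let ?K = "\<lambda>j j'. kron (?c j ** ?c' j' ** mpow (Zmat T) (?q + ?q')) (ent T j i ** ent T' j' i')"
  have product: "kron (?c j ** mpow (Zmat T) ?q) (ent T j i) ** kron (?c' j' ** mpow (Zmat T) ?q') (ent T' j' i') =
      (- 1 :: real) ^ ((par T' j' + par T' k') * ?q) *\<^sub>R ?K j j'"
    if "j' \<in> labels T'" for j j'
  proof -
    have "?c j ** mpow (Zmat T) ?q ** (?c' j' ** mpow (Zmat T) ?q') =
        (- 1 :: real) ^ ((par T' j' + par T' k') * ?q) *\<^sub>R (?c j ** ?c' j' ** mpow (Zmat T) (?q + ?q'))"
      unfolding mpow_add[of _ ?q ?q']
      by (rule matrix_mul_swap_middle) (use mpow_Zmat_cnj_ent[OF T' that k', of ?q] in \<open>simp only: Z\<close>)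
    then show ?thesis
      by (simp add: kron_mult kron_scaleR_left)
  qed
  have blocked: "kron (cnj_mat (ent (block T T') (j, j') (k, k')) **
        mpow (Zmat T) (par (block T T') (k, k') + par (block T T') (i, i'))) (ent (block T T') (j, j') (i, i')) =
      (- 1 :: real) ^ (par T k * (par T' j' + par T' k') + par T i * (par T' j' + par T' i')) *\<^sub>R ?K j j'" for j j'
  proof -
    have "even ((par T k + par T' k') mod 2 + (par T i + par T' i') mod 2) \<longleftrightarrow> even (?q + ?q')"
      by auto
    then have "mpow (Zmat T) ((par T k + par T' k') mod 2 + (par T i + par T' i') mod 2) = mpow (Zmat T) (?q + ?q')"
      by (simp only: mpow_Zmat)
    then show ?thesis
      by (simp add: cnj_mat_scaleR cnj_mat_mult matrix_mul_simps kron_scaleR_left kron_scaleR_right power_add mult.commute)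
  qed
  have sign: "(- 1 :: real) ^ (par T k * (par T' j' + par T' k') + par T i * (par T' j' + par T' i')) =
      (- 1) ^ (par T i * ?q') * (- 1) ^ ((par T' j' + par T' k') * ?q)" for j'
    unfolding power_add[symmetric] by (rule minus_one_power_cong) auto
  have "double_ent T k i ** double_ent T' k' i' =
      (\<Sum>j\<in>labels T. \<Sum>j'\<in>labels T'. (- 1 :: real) ^ ((par T' j' + par T' k') * ?q) *\<^sub>R ?K j j')"
    unfolding double_ent_kron matrix_mul_sum_left Z
    unfolding matrix_mul_sum_right by (intro sum.cong refl product)
  moreover have "double_ent (block T T') (k, k') (i, i') =
      (\<Sum>j\<in>labels T. \<Sum>j'\<in>labels T'.
        ((- 1 :: real) ^ (par T i * ?q') * (- 1) ^ ((par T' j' + par T' k') * ?q)) *\<^sub>R ?K j j')"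
    unfolding double_ent_kron Z block_simps(1) sum.cartesian_product[symmetric] sign[symmetric]
    unfolding sum.cartesian_product
    by (intro sum.cong refl) (simp only: case_prod_conv split_paired_all blocked)
  ultimately show ?thesis
    by (simp add: scaleR_sum_right)
qed

text \<open>The accumulated sign is left unspecified, except that it is 1 on equal words, where the
  trace and the sandwich condition are sensitive to it.\<close>

lemma double_ent_blocked:
  assumes "even_tensor T" "length ks = length is" "set ks \<subseteq> labels T"
  shows "\<exists>s::real. s * s = 1 \<and> (ks = is \<longrightarrow> s = 1) \<and>
    double_ent (blocked T (length ks)) ks is = s *\<^sub>R wprod (double_ent T) ks is"
  using assms(2,3)
proof (induction ks "is" rule: list_induct2)
  case Nil
  have "double_ent (blocked T 0) [] [] = mat 1"
    by (simp add: double_ent_kron cnj_mat_one kron_one)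
  then show ?case by simp
next
  case (Cons k ks i "is")
  then obtain s :: real where s: "s * s = 1" "ks = is \<Longrightarrow> s = 1"
    "double_ent (blocked T (length ks)) ks is = s *\<^sub>R wprod (double_ent T) ks is"
    by auto
  let ?par = "par (blocked T (length ks))"
  let ?s = "(- 1 :: real) ^ (par T i * (?par ks + ?par is))"
  have "double_ent (blocked T (length (k # ks))) (k # ks) (i # is) =
      ?s *\<^sub>R (double_ent T k i ** double_ent (blocked T (length ks)) ks is)"
    using Cons.prems assms(1)
    by (simp add: double_ent_cons_labels double_ent_block even_tensor_blocked labels_blocked)
  also have "\<dots> = (?s * s) *\<^sub>R wprod (double_ent T) (k # ks) (i # is)"
    by (simp add: s matrix_mul_simps)
  finally have "double_ent (blocked T (length (k # ks))) (k # ks) (i # is) =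
      (?s * s) *\<^sub>R wprod (double_ent T) (k # ks) (i # is)" .
  moreover have "(?s * s) * (?s * s) = (?s * ?s) * (s * s)"
    by (simp only: mult_ac)
  then have "(?s * s) * (?s * s) = 1"
    by (simp add: s flip: power_mult_distrib)
  moreover have "k # ks = i # is \<longrightarrow> ?s * s = 1"
    by (simp add: s minus_one_power_iff)
  ultimately show ?case by blast
qed

section \<open>Transfer matrices and simplicity of blocked tensors\<close>

lemma transfer_mat_average: "transfer_mat T = average (labels T) (double_ent T)"
  by (simp add: transfer_mat_def average_def)

text \<open>On diagonal labels the sign in \<open>double_ent_block\<close> has an even exponent, so
  the double sum factorizes.\<close>

lemma transfer_mat_cons_labels_block:
  assumes "even_tensor T'" "apar T' = apar T"
  shows "transfer_mat (cons_labels (block T T')) = transfer_mat T ** transfer_mat T'"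
proof -
  have inj: "inj_on (\<lambda>x. fst x # snd x) (labels T \<times> labels T')"
    by (simp add: inj_on_def prod_eq_iff)
  have "double_ent (cons_labels (block T T')) (i # i') (i # i') = double_ent T i i ** double_ent T' i' i'"
    if "i' \<in> labels T'" for i i'
    using that assms by (simp add: double_ent_cons_labels double_ent_block)
  then have "(\<Sum>i\<in>labels (cons_labels (block T T')). double_ent (cons_labels (block T T')) i i) =
      (\<Sum>i\<in>labels T. \<Sum>i'\<in>labels T'. double_ent T i i ** double_ent T' i' i')"
    by (simp add: sum.reindex[OF inj] sum.cartesian_product case_prod_unfold mem_Times_iff)
  also have "\<dots> = (\<Sum>i\<in>labels T. double_ent T i i) ** (\<Sum>i'\<in>labels T'. double_ent T' i' i')"
    unfolding matrix_mul_sum_left by (simp only: matrix_mul_sum_right)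
  finally show ?thesis
    by (simp add: transfer_mat_def matrix_mul_simps card_image[OF inj] card_cartesian_product)
qed

lemma transfer_mat_blocked:
  assumes "even_tensor T"
  shows "transfer_mat (blocked T k) = mpow (transfer_mat T) k"
proof (induction k)
  case 0
  show ?case
    by (simp add: transfer_mat_def double_ent_kron cnj_mat_one kron_one)
next
  case (Suc k)
  then show ?case
    using assms by (simp add: transfer_mat_cons_labels_block even_tensor_blocked)
qed

lemma simple_tensor_blocked:
  assumes T: "even_tensor T" and simple: "simple_words (labels T) (double_ent T) n"
  shows "simple_tensor (blocked T n)"
proof -
  let ?P = "mpow (transfer_mat T) n" and ?w = "wprod (double_ent T)"
  let ?C = "labels (blocked T n)"
  have C: "?C = {ks. length ks = n \<and> set ks \<subseteq> labels T}"
    by (rule labels_blocked)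
  note S = simple[unfolded simple_words_def Let_def, folded transfer_mat_average C]
  have d: "\<exists>s::real. s * s = 1 \<and> (k = i \<longrightarrow> s = 1) \<and> double_ent (blocked T n) k i = s *\<^sub>R ?w k i"
    if "k \<in> ?C" "i \<in> ?C" for k i
    using double_ent_blocked[OF T, of k i] that by (auto simp: C)
  show ?thesis
    unfolding simple_tensor_def transfer_mat_blocked[OF T]
  proof (intro conjI ballI)
    show "?P ** ?P = ?P"
      using S by blast
  next
    fix k i assume k: "k \<in> ?C" "i \<in> ?C"
    obtain s :: real where s: "k = i \<longrightarrow> s = 1" "double_ent (blocked T n) k i = s *\<^sub>R ?w k i"
      using d[OF k] by blast
    have "?P ** ?w k i ** ?P = (if k = i then ?P else 0)"
      using S k by blast
    with s show "?P ** double_ent (blocked T n) k i ** ?P = (if k = i then ?P else 0)"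
      by (simp add: matrix_mul_simps)
  next
    fix k i k' i' assume k: "k \<in> ?C" "i \<in> ?C" and k': "k' \<in> ?C" "i' \<in> ?C"
    obtain s s' :: real where s: "double_ent (blocked T n) k i = s *\<^sub>R ?w k i"
      "double_ent (blocked T n) k' i' = s' *\<^sub>R ?w k' i'"
      using d[OF k] d[OF k'] by blast
    have "?w k i ** ?w k' i' = ?w k i ** ?P ** ?w k' i'"
      using S k k' by blast
    with s show "double_ent (blocked T n) k i ** double_ent (blocked T n) k' i' =
        double_ent (blocked T n) k i ** ?P ** double_ent (blocked T n) k' i'"
      by (simp add: matrix_mul_simps)
  qed
qed

subsection \<open>Matrix elements of the generated operators\<close>

lemma confs_blocked: "confs T N = labels (blocked T N)"
  by (simp add: confs_def labels_blocked)

text \<open>The exponent of the Jordan-Wigner sign collected by the ordered product of the operators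
  \<open>f_op\<close> acting on the configuration \<open>ms\<close>.\<close>

definition jw_exponent :: "('p, 'b::finite) ftensor \<Rightarrow> 'p list \<Rightarrow> 'p list \<Rightarrow> nat" where
  "jw_exponent T ns ms = (\<Sum>y<length ms. (par T (ns ! y) + par T (ms ! y)) * (\<Sum>z<y. par T (ms ! z)))"

text \<open>The operators act with the last site first. When the operator at site \<open>y\<close>
  reads the parities to its left, these sites still carry the input \<open>p\<close>, which is why
  all string signs are evaluated on \<open>p\<close>.\<close>

lemma foldr_f_op:
  assumes T: "finite (labels T)" and x: "x \<le> N"
    and ns: "ns \<in> confs T N" and ms: "ms \<in> confs T N" and p': "p' \<in> confs T N" and p: "p \<in> confs T N"
  shows "foldr (op_mult T N) (map (\<lambda>y. f_op T y (ns ! y) (ms ! y)) [x..<N]) op_id p' p =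
    (if drop x p = drop x ms \<and> p' = take x p @ drop x ns
     then (- 1) ^ (\<Sum>y=x..<N. (par T (ns ! y) + par T (ms ! y)) * (\<Sum>z<y. par T (p ! z))) else 0)"
  using x p'
proof (induction x arbitrary: p' rule: inc_induct)
  case base
  then show ?case using ns ms p by (auto simp: op_id_def confs_def)
next
  case (step x)
  let ?G = "foldr (op_mult T N) (map (\<lambda>y. f_op T y (ns ! y) (ms ! y)) [Suc x..<N]) op_id"
  let ?s = "(- 1 :: complex) ^ (\<Sum>y=Suc x..<N. (par T (ns ! y) + par T (ms ! y)) * (\<Sum>z<y. par T (p ! z)))"
  \<comment> \<open>The only intermediate configuration that can contribute: the sites after
    \<open>x\<close> are already updated, all others are still those of \<open>p\<close>.\<close>
  define q0 where "q0 = take (Suc x) p @ drop (Suc x) ns"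
  have len: "length p = N" "length ns = N" "length ms = N"
    using ns ms p by (auto simp: confs_def)
  have fin: "finite (confs T N)"
    using finite_lists_length_eq[OF T, of N] by (simp add: confs_def conj_commute)
  have q0: "q0 \<in> confs T N"
    using ns p step.hyps by (auto simp: confs_def q0_def dest: in_set_takeD in_set_dropD)
  have "foldr (op_mult T N) (map (\<lambda>y. f_op T y (ns ! y) (ms ! y)) [x..<N]) op_id p' p =
      (\<Sum>q\<in>confs T N. f_op T x (ns ! x) (ms ! x) p' q * ?G q p)"
    using step.hyps by (simp add: upt_conv_Cons op_mult_def)
  also have "\<dots> = (\<Sum>q\<in>confs T N. if q = q0 then
      (if drop (Suc x) p = drop (Suc x) ms then f_op T x (ns ! x) (ms ! x) p' q0 * ?s else 0) else 0)"
    by (intro sum.cong refl) (simp add: step.IH q0_def)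
  also have "\<dots> = (if drop (Suc x) p = drop (Suc x) ms then f_op T x (ns ! x) (ms ! x) p' q0 * ?s else 0)"
    using fin q0 by simp
  also have "\<dots> = (if drop x p = drop x ms \<and> p' = take x p @ drop x ns
     then (- 1) ^ (\<Sum>y=x..<N. (par T (ns ! y) + par T (ms ! y)) * (\<Sum>z<y. par T (p ! z))) else 0)"
  proof -
    have "drop x p = drop x ms \<longleftrightarrow> p ! x = ms ! x \<and> drop (Suc x) p = drop (Suc x) ms"
      using step.hyps len by (metis Cons_nth_drop_Suc list.inject)
    moreover have "q0 ! x = p ! x"
      using step.hyps len by (simp add: q0_def nth_append)
    moreover have "q0[x := ns ! x] = take x p @ drop x ns"
      using step.hyps len
      by (simp add: q0_def list_update_append take_Suc_conv_app_nth Cons_nth_drop_Suc)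
    moreover have "(\<Sum>y<x. par T (q0 ! y)) = (\<Sum>y<x. par T (p ! y))"
      using step.hyps len by (intro sum.cong refl) (simp add: q0_def nth_append)
    ultimately show ?thesis
      using step.hyps by (auto simp: f_op_def sum.atLeast_Suc_lessThan power_add)
  qed
  finally show ?case .
qed

lemma f_prod_eq:
  assumes T: "finite (labels T)"
    and c: "ns \<in> confs T N" "ms \<in> confs T N" "p' \<in> confs T N" "p \<in> confs T N"
  shows "f_prod T N ns ms p' p = (if p = ms \<and> p' = ns then (- 1) ^ jw_exponent T ns ms else 0)"
  using foldr_f_op[OF T le0 c] c
  by (auto simp: f_prod_def jw_exponent_def confs_def atLeast0LessThan)

text \<open>Prepending a site adds its input parity to the string of every later site, and this is
  the sign in the blocking rule modulo 2.\<close>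

lemma ent_blocked:
  assumes "length ns = length ms"
  shows "ent (blocked T (length ns)) ns ms = (- 1 :: real) ^ jw_exponent T ns ms *\<^sub>R ent_prod T ns ms"
  using assms
proof (induction ns ms rule: list_induct2)
  case Nil
  show ?case by (simp add: jw_exponent_def ent_prod_def)
next
  case (Cons n ns m ms)
  let ?par = "par (blocked T (length ns))"
  have sl: "sum_list (map (par T) xs) = (\<Sum>y<length xs. par T (xs ! y))" for xs
    by (simp add: sum_list_sum_nth atLeast0LessThan)
  have "jw_exponent T (n # ns) (m # ms) =
      (\<Sum>y<length ms. (par T (ns ! y) + par T (ms ! y)) * (par T m + (\<Sum>z<y. par T (ms ! z))))"
    by (simp add: jw_exponent_def sum.lessThan_Suc_shift del: sum.lessThan_Suc)
  also have "\<dots> = par T m * (sum_list (map (par T) ns) + sum_list (map (par T) ms)) + jw_exponent T ns ms"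
    using Cons.hyps
    by (simp add: jw_exponent_def sl algebra_simps sum.distrib sum_distrib_left)
  finally have "even (jw_exponent T (n # ns) (m # ms)) =
      even (par T m * (?par ns + ?par ms) + jw_exponent T ns ms)"
    using par_blocked[of T ns] par_blocked[of T ms] Cons.hyps by simp
  then have "(- 1 :: real) ^ jw_exponent T (n # ns) (m # ms) =
      (- 1) ^ (par T m * (?par ns + ?par ms)) * (- 1) ^ jw_exponent T ns ms"
    unfolding power_add[symmetric] by (rule minus_one_power_cong)
  then show ?case
    by (simp add: Cons.IH matrix_mul_simps ent_prod_def)
qed

lemma mpo_eq_trace:
  assumes T: "finite (labels T)" and p': "p' \<in> confs T N" and p: "p \<in> confs T N"
  shows "mpo S T N p' p = trace (S ** ent (blocked T N) p' p)"
proof -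
  have fin: "finite (confs T N)"
    using finite_lists_length_eq[OF T, of N] by (simp add: confs_def conj_commute)
  let ?t = "trace (S ** ent_prod T p' p) * (- 1) ^ jw_exponent T p' p"
  have "mpo S T N p' p = (\<Sum>ns\<in>confs T N. \<Sum>ms\<in>confs T N. if ms = p then (if ns = p' then ?t else 0) else 0)"
    unfolding mpo_def by (intro sum.cong refl) (use p p' in \<open>auto simp: f_prod_eq[OF T]\<close>)
  also have "\<dots> = ?t"
    using fin p p' by simp
  also have "\<dots> = trace (S ** ((- 1 :: real) ^ jw_exponent T p' p *\<^sub>R ent_prod T p' p))"
    by (simp add: matrix_mul_simps trace_scaleR scaleR_conv_of_real[where 'a = complex])
  also have "\<dots> = trace (S ** ent (blocked T N) p' p)"
    using ent_blocked[of p' p T] p p' by (simp add: confs_def)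
  finally show ?thesis .
qed

subsection \<open>Traces of the words in the doubled tensor\<close>

lemma trace_anticommuting_Zmat:
  assumes "Zmat T ** A = - (A ** Zmat T)"
  shows "trace A = 0"
proof -
  have "trace A = trace (A ** Zmat T ** Zmat T)"
    by (simp add: Zmat_sq flip: matrix_mul_assoc)
  also have "\<dots> = trace (Zmat T ** A ** Zmat T)"
    by (metis trace_mul_sym matrix_mul_assoc)
  also have "\<dots> = trace (- (A ** Zmat T) ** Zmat T)"
    by (simp add: assms)
  also have "\<dots> = - trace A"
    by (simp add: matrix_mul_minus_left Zmat_sq trace_def sum_negf flip: matrix_mul_assoc)
  finally show ?thesis by simp
qed

text \<open>An odd matrix stays odd, hence traceless, after multiplication by \<open>Z\<close>, so the sign
  in the doubled tensor does not contribute to the trace.\<close>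

lemma trace_double_ent:
  assumes T: "even_tensor T" and k: "k \<in> labels T" and i: "i \<in> labels T"
  shows "trace (double_ent T k i) = (\<Sum>j\<in>labels T. cnj (trace (ent T j k)) * trace (ent T j i))"
proof -
  have odd: "trace (ent T j m) = 0" if "odd (par T j + par T m)" "j \<in> labels T" "m \<in> labels T" for j m
    using Zmat_ent[OF T that(2,3)] that(1) by (intro trace_anticommuting_Zmat[of T]) simp
  have "trace (cnj_mat (ent T j k) ** mpow (Zmat T) (par T k + par T i)) * trace (ent T j i) =
      cnj (trace (ent T j k)) * trace (ent T j i)" if j: "j \<in> labels T" for j
  proof (cases "even (par T k + par T i) \<or> odd (par T j + par T i)")
    case True
    then show ?thesis
      using odd[OF _ j i] by (auto simp: mpow_Zmat trace_cnj_mat)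
  next
    case False
    \<comment> \<open>Here \<open>k\<close> and \<open>i\<close> differ in parity while
      \<open>j\<close> and \<open>i\<close> agree, so the conjugated factor is odd and traceless
      with or without \<open>Z\<close>.\<close>
    then have jk: "odd (par T j + par T k)" by auto
    have "Zmat T ** cnj_mat (ent T j k) = - (cnj_mat (ent T j k) ** Zmat T)"
      using mpow_Zmat_cnj_ent[OF T j k, of 1] jk by simp
    then have "trace (cnj_mat (ent T j k) ** Zmat T) = 0"
      by (intro trace_anticommuting_Zmat[of T]) (simp add: matrix_mul_assoc matrix_mul_minus_left)
    then show ?thesis
      using False odd[OF jk j k] by (simp add: mpow_Zmat)
  qed
  then show ?thesis
    unfolding double_ent_kron trace_sum trace_kron by (rule sum.cong[OF refl])
qed

text \<open>The left-hand side is, up to the sign of blocking, a matrix element of the adjoint of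
  the generated operator times that operator. The sign is 1 where the element is 1 and harmless
  where it is 0.\<close>

lemma trace_wprod_double_ent:
  assumes T: "even_tensor T" and unitary: "\<forall>N\<ge>1. unitary_op T N (mpo (mat c) T N)"
    and ks: "ks \<noteq> []" "length ks = length is" "set ks \<subseteq> labels T" "set is \<subseteq> labels T"
  shows "cnj c * c * trace (wprod (double_ent T) ks is) = (if ks = is then 1 else 0)"
proof -
  define N where "N = length ks"
  have N: "N \<ge> 1" using ks(1) by (simp add: N_def Suc_le_eq)
  have fin: "finite (labels T)"
    using T by (simp add: even_tensor_def)
  have c: "ks \<in> confs T N" "is \<in> confs T N"
    using ks by (auto simp: confs_def N_def)
  have mpo: "mpo (mat c) T N q p = c * trace (ent (blocked T N) q p)" if "q \<in> confs T N" "p \<in> confs T N" for q p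
  proof -
    have "(mat c ** A) $ x $ y = c * A $ x $ y" for A :: "complex^'b^'b" and x y
    proof -
      have "(mat c :: complex^'b^'b) $ x $ z * A $ z $ y = (if z = x then c * A $ x $ y else 0)" for z
        by (simp add: mat_def)
      then show ?thesis
        by (simp add: matrix_matrix_mult_def)
    qed
    then show ?thesis
      by (simp add: mpo_eq_trace[OF fin that] trace_def sum_distrib_left)
  qed
  have "cnj c * c * trace (double_ent (blocked T N) ks is) =
      (\<Sum>q\<in>confs T N. cnj (mpo (mat c) T N q ks) * mpo (mat c) T N q is)"
    using c by (simp add: trace_double_ent[OF even_tensor_blocked[OF T]] mpo confs_blocked[symmetric]
        sum_distrib_left mult_ac cong: sum.cong)
  also have "\<dots> = op_mult T N (op_adj (mpo (mat c) T N)) (mpo (mat c) T N) ks is"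
    by (simp add: op_mult_def op_adj_def)
  also have "\<dots> = (if ks = is then 1 else 0)"
    using unitary N c by (simp add: unitary_op_def op_id_def)
  finally have *: "cnj c * c * trace (double_ent (blocked T N) ks is) = (if ks = is then 1 else 0)" .
  obtain s :: real where s: "s * s = 1" "ks = is \<longrightarrow> s = 1"
    "double_ent (blocked T N) ks is = s *\<^sub>R wprod (double_ent T) ks is"
    using double_ent_blocked[OF T ks(2,3)] by (auto simp: N_def)
  then have "s \<noteq> 0" by auto
  with * s show ?thesis
    by (auto simp: trace_scaleR split: if_splits)
qed

section \<open>The two types of tensors\<close>

lemma simple_tensor_type_I:
  fixes T :: "('p, 'b::finite) ftensor"
  assumes "type_I_fMPU S T"
  shows "simple_tensor (blocked T (CARD('b)\<^sup>2))"
proof -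
  from assms obtain \<alpha> where T: "even_tensor T"
    and U: "\<forall>N\<ge>1. unitary_op T N (mpo (mat (cis \<alpha>)) T N)"
    unfolding type_I_fMPU_def by blast
  have one: "cnj (cis \<alpha>) * cis \<alpha> = 1"
    by (simp add: cis_cnj cis_mult)
  have "simple_words (labels T) (double_ent T) CARD('b \<times> 'b)"
  proof (rule simple_words_if_traces)
    fix ks "is" :: "'p list"
    assume "ks \<noteq> []" "length ks = length is" "set ks \<subseteq> labels T" "set is \<subseteq> labels T"
    then show "trace (wprod (double_ent T) ks is) = (if ks = is then 1 else 0)"
      using trace_wprod_double_ent[OF T U, of ks "is"] unfolding one by simp
  qed (use T in \<open>simp_all add: even_tensor_def\<close>)
  then show ?thesis
    using simple_tensor_blocked[OF T] by (simp add: power2_eq_square)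
qed

text \<open>The two layers may each commute only up to a sign depending on the summed label
  \<open>j\<close>; if the signs agree, they cancel in the Kronecker product.\<close>

lemma double_ent_commute:
  assumes "\<And>j. j \<in> labels T \<Longrightarrow>
    A ** (cnj_mat (ent T j k) ** mpow (Zmat T) (par T k + par T i)) =
      s j *\<^sub>R (cnj_mat (ent T j k) ** mpow (Zmat T) (par T k + par T i) ** A)"
    and "\<And>j. j \<in> labels T \<Longrightarrow> B ** ent T j i = s j *\<^sub>R (ent T j i ** B)"
    and "\<And>j. j \<in> labels T \<Longrightarrow> s j * s j = 1"
  shows "kron A B ** double_ent T k i = double_ent T k i ** kron A B"
  unfolding double_ent_kron matrix_mul_sum_left matrix_mul_sum_right
  by (intro sum.cong refl) (simp add: kron_mult assms kron_scaleR_left kron_scaleR_right)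

lemma simple_tensor_type_II:
  fixes T :: "('p, bool \<times> 'h::finite) ftensor"
  assumes "type_II_fMPU S T"
  shows "simple_tensor (blocked T (CARD(bool \<times> 'h)\<^sup>2))"
proof -
  from assms obtain \<alpha> Nm where T: "even_tensor T"
    and U: "\<forall>N\<ge>1. unitary_op T N (mpo (mat (cis \<alpha> / complex_of_real (sqrt 2))) T N)"
    and Z: "Zmat T = kron sigma_z (mat 1)"
    and Nm: "\<forall>n\<in>labels T. \<forall>m\<in>labels T. ent T n m = kron (mpow sigma_x (par T n + par T m)) (Nm n m)"
    unfolding type_II_fMPU_def by blast
  define X :: "complex^(bool \<times> 'h)^(bool \<times> 'h)" where "X = kron sigma_x (mat 1)"
  have xx: "sigma_x ** sigma_x = mat 1" and xz: "sigma_x ** sigma_z = - (sigma_z ** sigma_x)"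
    by (simp_all add: vec_eq_iff matrix_matrix_mult_def sigma_x_def sigma_z_def mat_def UNIV_bool)
  have XX: "X ** X = mat 1"
    by (simp add: X_def kron_mult xx kron_one)
  have XZ: "X ** Zmat T = - (Zmat T ** X)"
    by (simp add: X_def Z kron_mult xz kron_minus_left)
  have ZZ: "Zmat T ** Zmat T = mat 1"
    by (rule Zmat_sq)
  have cX: "cnj_mat X = X"
    by (simp add: X_def vec_eq_iff cnj_mat_def kron_def sigma_x_def mat_def)
  have sx: "sigma_x ** mpow sigma_x q = mpow sigma_x q ** sigma_x" for q
    using mpow_add[of sigma_x 1 q] mpow_add[of sigma_x q 1] by simp
  have XU: "X ** ent T n m = ent T n m ** X" if "n \<in> labels T" "m \<in> labels T" for n m
    using Nm that by (simp add: X_def kron_mult sx)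
  then have XcU: "X ** cnj_mat (ent T n m) = cnj_mat (ent T n m) ** X" if "n \<in> labels T" "m \<in> labels T" for n m
    using cnj_mat_mult[of X "ent T n m"] cnj_mat_mult[of "ent T n m" X] that by (simp add: cX)
  \<comment> \<open>\<open>X\<close> commutes with the matrices of the tensor and anticommutes with
    \<open>Z\<close>. In \<open>?F\<close>, passing \<open>X\<close> through the power of
    \<open>Z\<close> in the conjugated layer corrects the sign from \<open>|j| + |k|\<close> to
    \<open>|j| + |i|\<close>, which is the sign of \<open>Z\<close> in the other layer.\<close>
  let ?R = "kron (mat 1) X" and ?F = "kron (X ** Zmat T) (Zmat T)"
  have XZXZ: "X ** Zmat T ** (X ** Zmat T) = - mat 1"
  proof -
    have "X ** Zmat T ** (X ** Zmat T) = X ** (Zmat T ** X) ** Zmat T"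
      by (simp add: matrix_mul_assoc)
    also have "Zmat T ** X = - (X ** Zmat T)"
      by (simp add: XZ)
    also have "X ** - (X ** Zmat T) ** Zmat T = - (X ** X ** (Zmat T ** Zmat T))"
      by (simp add: matrix_mul_minus_left matrix_mul_minus_right matrix_mul_assoc)
    finally show ?thesis by (simp add: XX ZZ)
  qed
  have commF: "?F ** double_ent T k i = double_ent T k i ** ?F" if k: "k \<in> labels T" and i: "i \<in> labels T" for k i
  proof (rule double_ent_commute)
    fix j assume j: "j \<in> labels T"
    let ?U = "cnj_mat (ent T j k)" and ?q = "par T k + par T i"
    have "Zmat T ** (?U ** mpow (Zmat T) ?q) = (mpow (Zmat T) 1 ** ?U) ** mpow (Zmat T) ?q"
      by (simp add: matrix_mul_assoc)
    also have "\<dots> = (- 1 :: real) ^ (par T j + par T k) *\<^sub>R (?U ** mpow (Zmat T) ?q ** Zmat T)"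
      unfolding mpow_Zmat_cnj_ent[OF T j k] by (simp add: mpow_Zmat matrix_mul_simps flip: matrix_mul_assoc)
    finally have 1: "Zmat T ** (?U ** mpow (Zmat T) ?q) = \<dots>" .
    have 2: "X ** (?U ** mpow (Zmat T) ?q) = (- 1 :: real) ^ ?q *\<^sub>R (?U ** mpow (Zmat T) ?q ** X)"
    proof -
      have "X ** mpow (Zmat T) ?q = (- 1 :: real) ^ ?q *\<^sub>R (mpow (Zmat T) ?q ** X)"
        by (simp add: mpow_Zmat XZ)
      then show ?thesis
        by (simp add: matrix_mul_assoc XcU[OF j k]) (simp add: matrix_mul_scaleR_right flip: matrix_mul_assoc)
    qed
    have "X ** Zmat T ** (?U ** mpow (Zmat T) ?q) = (- 1 :: real) ^ (par T j + par T k) *\<^sub>R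
        (X ** (?U ** mpow (Zmat T) ?q) ** Zmat T)"
      using 1 by (simp add: matrix_mul_scaleR_right flip: matrix_mul_assoc)
    also have "\<dots> = ((- 1 :: real) ^ (par T j + par T k) * (- 1) ^ ?q) *\<^sub>R (?U ** mpow (Zmat T) ?q ** (X ** Zmat T))"
      unfolding 2 by (simp add: matrix_mul_scaleR_left flip: matrix_mul_assoc)
    also have "(- 1 :: real) ^ (par T j + par T k) * (- 1) ^ ?q = (- 1) ^ (par T j + par T i)"
      unfolding power_add[symmetric] by (rule minus_one_power_cong) auto
    finally show "X ** Zmat T ** (?U ** mpow (Zmat T) ?q) =
        (- 1 :: real) ^ (par T j + par T i) *\<^sub>R (?U ** mpow (Zmat T) ?q ** (X ** Zmat T))" .
    show "Zmat T ** ent T j i = (- 1 :: real) ^ (par T j + par T i) *\<^sub>R (ent T j i ** Zmat T)"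
      by (rule Zmat_ent[OF T j i])
  qed (simp flip: power_mult_distrib)
  have commR: "?R ** double_ent T k i = double_ent T k i ** ?R" if "k \<in> labels T" "i \<in> labels T" for k i
    by (rule double_ent_commute[where s = "\<lambda>_. 1"]) (use that XU in simp_all)
  have sqrt2: "complex_of_real (sqrt 2) * complex_of_real (sqrt 2) = 2"
    unfolding of_real_mult[symmetric] real_sqrt_mult_self by simp
  \<comment> \<open>The squared modulus of the boundary factor is 1/2, which makes the traces of
    diagonal words equal to 2.\<close>
  have half: "cnj (cis \<alpha> / complex_of_real (sqrt 2)) * (cis \<alpha> / complex_of_real (sqrt 2)) = 1 / 2"
    by (simp add: mult.commute[of "cnj _"] norm_divide power_divide sqrt2 flip: complex_norm_square)
  have "simple_words (labels T) (double_ent T) CARD((bool \<times> 'h) \<times> (bool \<times> 'h))"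
  proof (rule simple_words_if_doubled_traces[where F = ?F and R = ?R])
    fix ks "is" :: "'p list"
    assume "ks \<noteq> []" "length ks = length is" "set ks \<subseteq> labels T" "set is \<subseteq> labels T"
    then show "trace (wprod (double_ent T) ks is) = (if ks = is then 2 else 0)"
      using trace_wprod_double_ent[OF T U, of ks "is"] unfolding half by (auto split: if_splits)
  next
    show "?R ** ?R = mat 1"
      by (simp add: kron_mult XX kron_one)
    show "?F ** ?F = - mat 1"
      by (simp add: kron_mult XZXZ ZZ kron_minus_left kron_one)
    show "?F ** ?R = - (?R ** ?F)"
      by (simp add: kron_mult XZ kron_minus_right)
  qed (use T in \<open>simp_all add: even_tensor_def commF commR\<close>)
  then show ?thesis
    using simple_tensor_blocked[OF T] by (simp only: card_prod power2_eq_square)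
qed

theorem mainTheorem7:
  fixes T1 :: "('p, 'b::finite) ftensor" and S1 :: "complex ^ 'b ^ 'b"
    and T2 :: "('q, bool \<times> 'h::finite) ftensor" and S2 :: "complex ^ (bool \<times> 'h) ^ (bool \<times> 'h)"
  shows "(type_I_fMPU S1 T1 \<longrightarrow>
            (\<exists>k. 1 \<le> k \<and> k \<le> CARD('b) ^ 4 \<and> simple_tensor (blocked T1 k))) \<and>
         (type_II_fMPU S2 T2 \<longrightarrow>
            (\<exists>k. 1 \<le> k \<and> k \<le> CARD(bool \<times> 'h) ^ 4 \<and> simple_tensor (blocked T2 k)))"
proof -
  \<comment> \<open>The blocking length is the dimension \<open>D\<^sup>2\<close> of the doubled
    auxiliary space on which the words act.\<close>
  have bound: "1 \<le> D\<^sup>2 \<and> D\<^sup>2 \<le> D ^ 4" if "D > 0" for D :: nat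
    using that by (simp add: power_increasing Suc_le_eq)
  show ?thesis
  proof (intro conjI impI)
    assume "type_I_fMPU S1 T1"
    then show "\<exists>k. 1 \<le> k \<and> k \<le> CARD('b) ^ 4 \<and> simple_tensor (blocked T1 k)"
      using simple_tensor_type_I bound[OF zero_less_card_finite] by blast
  next
    assume "type_II_fMPU S2 T2"
    then show "\<exists>k. 1 \<le> k \<and> k \<le> CARD(bool \<times> 'h) ^ 4 \<and> simple_tensor (blocked T2 k)"
      using simple_tensor_type_II bound[OF zero_less_card_finite] by blast
  qed
qed

end
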